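(* For every $n$, the monoids $TSB_n$ and $\mathsf{P}_n\rtimes SB_n$ are isomorphic.
   Context: $\mathsf{P}_n$ is the set of set partitions of $\{1,\dots,n\}$; $I\preceq J$ means each block of $J$ is a union of blocks of $I$; $\mathsf{P}_n$ is a commutative monoid with product $I\ast J$ = the minimal set partition $K$ with $I\preceq K$, $J\preceq K$. $S_n$ acts on $\mathsf{P}_n$ blockwise; $s_i=(i,i+1)$. The singular braid monoid $SB_n$ is generated by $\sigma_1^{\pm1},\dots,\sigma_{n-1}^{\pm1}$ and $\tau_1,\dots,\tau_{n-1}$ subject to the braid relations among the $\sigma_i$ and: $\tau_i\tau_j=\tau_j\tau_i$ and $\sigma_i\tau_j=\tau_j\sigma_i$ for $|i-j|>1$; $\sigma_i\tau_i=\tau_i\sigma_i$ for all $i$; $\sigma_i\sigma_j\tau_i=\tau_j\sigma_i\sigma_j$ for $|i-j|=1$. Let $\pi:SB_n\to S_n$ be the homomorphism $\sigma_i\mapsto s_i$, $\tau_i\mapsto s_i$; $\pi_\alpha=\pi(\alpha)$. $\mathsf{P}_n\rtimes SB_n$ is the set $\mathsf{P}_n\times SB_n$ with product $(I,\alpha)(J,\beta)=(I\ast\pi_\alpha(J),\alpha\beta)$. $TSB_n$ is the monoid presented by generators $\sigma_i^{\pm1},\tau_i,\eta_i$ ($1\le i\le n-1$) subject to: the defining relations of $SB_n$, namely $\sigma_i\sigma_i^{-1}=\sigma_i^{-1}\sigma_i=1$ for all $i$, $\sigma_i\sigma_j=\sigma_j\sigma_i$ for $|i-j|>1$, $\sigma_i\sigma_j\sigma_i=\sigma_j\sigma_i\sigma_j$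 for $|i-j|=1$, $\tau_i\tau_j=\tau_j\tau_i$ and $\sigma_i\tau_j=\tau_j\sigma_i$ for $|i-j|>1$, $\sigma_i\tau_i=\tau_i\sigma_i$ for all $i$, and $\sigma_i\sigma_j\tau_i=\tau_j\sigma_i\sigma_j$ for $|i-j|=1$; the relations $\eta_i\eta_j=\eta_j\eta_i$ for all $i,j$; $\eta_i\sigma_i=\sigma_i\eta_i$; $\eta_i\sigma_j=\sigma_j\eta_i$ for $|i-j|>1$; $\eta_i\sigma_j\sigma_i=\sigma_j\sigma_i\eta_j$, $\eta_i\sigma_j\sigma_i^{-1}=\sigma_j\sigma_i^{-1}\eta_j$ and $\eta_i\eta_j\sigma_i=\eta_j\sigma_i\eta_j=\sigma_i\eta_i\eta_j$ for $|i-j|=1$; $\eta_i^2=\eta_i$; and the relations: $\tau_i\eta_i=\eta_i\tau_i$ for all $i$; $\tau_i\eta_j=\eta_j\tau_i$ for $|i-j|>1$; and, for $|i-j|=1$, $\eta_i\tau_j\tau_i=\tau_j\tau_i\eta_j$, $\eta_i\eta_j\tau_i=\eta_j\tau_i\eta_j=\tau_i\eta_i\eta_j$, $\eta_i\tau_j\sigma_i=\tau_j\sigma_i\eta_j$, $\eta_i\sigma_j\tau_i=\sigma_j\tau_i\eta_j$, $\tau_i\eta_j=\sigma_i\eta_j\sigma_i^{-1}\tau_i$. *)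

theory Defs
  imports "HOL-Algebra.Sym_Groups" "HOL-Library.Disjoint_Sets"
begin

section \<open>Monoids given by generators and relations\<close>

text \<open>
  Words over the generating set \<open>G\<close> are the elements of \<open>lists G\<close>; \<open>pres_cong G R\<close> is the smallest
  congruence on this free monoid that contains the relations \<open>R\<close>.
\<close>

inductive_set pres_cong :: "'g set \<Rightarrow> ('g list \<times> 'g list) set \<Rightarrow> ('g list \<times> 'g list) set"
  for G :: "'g set" and R :: "('g list \<times> 'g list) set" where
  base: "(u, v) \<in> R \<Longrightarrow> u \<in> lists G \<Longrightarrow> v \<in> lists G \<Longrightarrow> (u, v) \<in> pres_cong G R"
| refl: "u \<in> lists G \<Longrightarrow> (u, u) \<in> pres_cong G R"
| sym: "(u, v) \<in> pres_cong G R \<Longrightarrow> (v, u) \<in> pres_cong G R"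
| trans: "(u, v) \<in> pres_cong G R \<Longrightarrow> (v, w) \<in> pres_cong G R \<Longrightarrow> (u, w) \<in> pres_cong G R"
| mult: "(u, v) \<in> pres_cong G R \<Longrightarrow> (x, y) \<in> pres_cong G R \<Longrightarrow> (u @ x, v @ y) \<in> pres_cong G R"

definition presented_monoid :: "'g set \<Rightarrow> ('g list \<times> 'g list) set \<Rightarrow> 'g list set monoid" where
  "presented_monoid G R =
    \<lparr> carrier = lists G // pres_cong G R,
      mult = (\<lambda>X Y. \<Union>x\<in>X. \<Union>y\<in>Y. pres_cong G R `` {x @ y}),
      one = pres_cong G R `` {[]} \<rparr>"

definition word_value :: "('a, 'b) monoid_scheme \<Rightarrow> ('g \<Rightarrow> 'a) \<Rightarrow> 'g list \<Rightarrow> 'a" where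
  "word_value H f w = foldr (\<lambda>g h. f g \<otimes>\<^bsub>H\<^esub> h) w \<one>\<^bsub>H\<^esub>"

text \<open>
  The homomorphism from a presented monoid to \<open>H\<close> that extends the assignment \<open>f\<close> of generators. It
  is meaningful when \<open>f\<close> respects the relations; see \<open>pres_lift_hom\<close> and \<open>pres_lift_class\<close>.
\<close>

definition pres_lift :: "('a, 'b) monoid_scheme \<Rightarrow> ('g \<Rightarrow> 'a) \<Rightarrow> 'g list set \<Rightarrow> 'a" where
  "pres_lift H f X = the_elem (word_value H f ` X)"

lemma pres_cong_in_lists: "(u, v) \<in> pres_cong G R \<Longrightarrow> u \<in> lists G \<and> v \<in> lists G"
  by (induction rule: pres_cong.induct) auto

lemma equiv_pres_cong: "equiv (lists G) (pres_cong G R)"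
proof (rule equivI)
  show "pres_cong G R \<subseteq> lists G \<times> lists G"
    using pres_cong_in_lists by fast
  show "refl_on (lists G) (pres_cong G R)"
    by (rule refl_onI) (auto intro: pres_cong.refl)
  show "sym (pres_cong G R)" by (rule symI) (rule pres_cong.sym)
  show "trans (pres_cong G R)" by (rule transI) (rule pres_cong.trans)
qed

lemma pres_class_eq_iff:
  "u \<in> lists G \<Longrightarrow> v \<in> lists G \<Longrightarrow>
    pres_cong G R `` {u} = pres_cong G R `` {v} \<longleftrightarrow> (u, v) \<in> pres_cong G R"
  using eq_equiv_class_iff[OF equiv_pres_cong] .

lemma presented_monoid_carrier:
  "X \<in> carrier (presented_monoid G R) \<longleftrightarrow> (\<exists>u\<in>lists G. X = pres_cong G R `` {u})"
  by (auto simp: presented_monoid_def quotient_def)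

lemma presented_monoid_mult:
  assumes "u \<in> lists G" "v \<in> lists G"
  shows "pres_cong G R `` {u} \<otimes>\<^bsub>presented_monoid G R\<^esub> pres_cong G R `` {v}
    = pres_cong G R `` {u @ v}"
proof -
  define U where "U = pres_cong G R `` {u}"
  define V where "V = pres_cong G R `` {v}"
  have eq: "pres_cong G R `` {x @ y} = pres_cong G R `` {u @ v}" if "x \<in> U" "y \<in> V" for x y
    using that equiv_class_eq[OF equiv_pres_cong pres_cong.mult[of u x G R v y]]
    by (simp add: U_def V_def)
  have "U \<noteq> {}" "V \<noteq> {}"
    using assms by (auto simp: U_def V_def intro: pres_cong.refl)
  then have "(\<Union>x\<in>U. \<Union>y\<in>V. pres_cong G R `` {x @ y}) = pres_cong G R `` {u @ v}"
    by (simp add: eq cong: SUP_cong)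
  then show ?thesis by (simp only: presented_monoid_def monoid.simps U_def V_def)
qed

lemma presented_monoid_one: "\<one>\<^bsub>presented_monoid G R\<^esub> = pres_cong G R `` {[]}"
  by (simp add: presented_monoid_def)

lemma monoid_presented_monoid: "monoid (presented_monoid G R)"
proof (rule monoidI)
  let ?c = "\<lambda>u. pres_cong G R `` {u}"
  fix X Y Z
  assume "X \<in> carrier (presented_monoid G R)"
  then obtain u where u: "u \<in> lists G" "X = ?c u"
    by (auto simp: presented_monoid_carrier)
  show "\<one>\<^bsub>presented_monoid G R\<^esub> \<otimes>\<^bsub>presented_monoid G R\<^esub> X = X"
    using u presented_monoid_mult[of "[]" G u R] by (simp add: presented_monoid_one)
  show "X \<otimes>\<^bsub>presented_monoid G R\<^esub> \<one>\<^bsub>presented_monoid G R\<^esub> = X"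
    using u presented_monoid_mult[of u G "[]" R] by (simp add: presented_monoid_one)
  assume "Y \<in> carrier (presented_monoid G R)"
  then obtain v where v: "v \<in> lists G" "Y = ?c v"
    by (auto simp: presented_monoid_carrier)
  have uv: "u @ v \<in> lists G" using u v by simp
  show "X \<otimes>\<^bsub>presented_monoid G R\<^esub> Y \<in> carrier (presented_monoid G R)"
    using u v uv by (auto simp: presented_monoid_mult presented_monoid_carrier simp del: append_in_lists_conv)
  assume "Z \<in> carrier (presented_monoid G R)"
  then obtain w where w: "w \<in> lists G" "Z = ?c w"
    by (auto simp: presented_monoid_carrier)
  show "X \<otimes>\<^bsub>presented_monoid G R\<^esub> Y \<otimes>\<^bsub>presented_monoid G R\<^esub> Z =
      X \<otimes>\<^bsub>presented_monoid G R\<^esub> (Y \<otimes>\<^bsub>presented_monoid G R\<^esub> Z)"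
    using u v w by (simp add: presented_monoid_mult)
next
  show "\<one>\<^bsub>presented_monoid G R\<^esub> \<in> carrier (presented_monoid G R)"
    by (auto simp: presented_monoid_one presented_monoid_carrier)
qed

lemma word_value_simps [simp]:
  "word_value H f [] = \<one>\<^bsub>H\<^esub>"
  "word_value H f (g # w) = f g \<otimes>\<^bsub>H\<^esub> word_value H f w"
  by (simp_all add: word_value_def)

context
  fixes H :: "('a, 'b) monoid_scheme" (structure) and G :: "'g set"
    and R :: "('g list \<times> 'g list) set" and f :: "'g \<Rightarrow> 'a"
  assumes H: "monoid H"
    and f: "\<And>g. g \<in> G \<Longrightarrow> f g \<in> carrier H"
begin

interpretation monoid H by (fact H)

lemma word_value_closed: "w \<in> lists G \<Longrightarrow> word_value H f w \<in> carrier H"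
  by (induction w) (auto intro: f)

lemma word_value_append:
  "u \<in> lists G \<Longrightarrow> v \<in> lists G \<Longrightarrow>
    word_value H f (u @ v) = word_value H f u \<otimes> word_value H f v"
  by (induction u) (auto simp: f word_value_closed m_assoc)

context
  assumes R: "\<And>u v. (u, v) \<in> R \<Longrightarrow> word_value H f u = word_value H f v"
begin

lemma word_value_cong: "(u, v) \<in> pres_cong G R \<Longrightarrow> word_value H f u = word_value H f v"
proof (induction rule: pres_cong.induct)
  case (mult u v x y)
  then show ?case
    using pres_cong_in_lists[OF mult.hyps(1)] pres_cong_in_lists[OF mult.hyps(2)]
    by (simp add: word_value_append)
qed (auto intro: R)

lemma pres_lift_class:
  assumes "w \<in> lists G"
  shows "pres_lift H f (pres_cong G R `` {w}) = word_value H f w"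
proof -
  have "w \<in> pres_cong G R `` {w}"
    using pres_cong.refl[OF assms] by simp
  moreover have "word_value H f x = word_value H f w" if "x \<in> pres_cong G R `` {w}" for x
    using that word_value_cong[of w x] by simp
  ultimately have "word_value H f ` (pres_cong G R `` {w}) = {word_value H f w}"
    by blast
  then show ?thesis by (simp add: pres_lift_def)
qed

lemma pres_lift_hom: "pres_lift H f \<in> hom (presented_monoid G R) H"
proof (rule homI)
  fix X assume "X \<in> carrier (presented_monoid G R)"
  then obtain u where u: "u \<in> lists G" "X = pres_cong G R `` {u}"
    by (auto simp: presented_monoid_carrier)
  show "pres_lift H f X \<in> carrier H"
    using u by (simp add: pres_lift_class word_value_closed)
  fix Y assume "Y \<in> carrier (presented_monoid G R)"
  then obtain v where v: "v \<in> lists G" "Y = pres_cong G R `` {v}"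
    by (auto simp: presented_monoid_carrier)
  show "pres_lift H f (X \<otimes>\<^bsub>presented_monoid G R\<^esub> Y) = pres_lift H f X \<otimes> pres_lift H f Y"
    using u v by (simp add: presented_monoid_mult pres_lift_class word_value_append)
qed

lemma pres_lift_one: "pres_lift H f \<one>\<^bsub>presented_monoid G R\<^esub> = \<one>"
  by (simp add: presented_monoid_one pres_lift_class)

end

end


section \<open>The monoid of set partitions\<close>

definition set_partitions :: "nat \<Rightarrow> nat set set set" where
  "set_partitions n = {I. partition_on {1..n} I}"

definition part_le :: "nat set set \<Rightarrow> nat set set \<Rightarrow> bool" (infix \<open>\<preceq>\<^sub>P\<close> 50) where
  "I \<preceq>\<^sub>P J \<longleftrightarrow> (\<forall>B\<in>J. \<exists>C\<subseteq>I. B = \<Union>C)"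

definition part_join :: "nat \<Rightarrow> nat set set \<Rightarrow> nat set set \<Rightarrow> nat set set" where
  "part_join n I J = (THE K. K \<in> set_partitions n \<and> I \<preceq>\<^sub>P K \<and> J \<preceq>\<^sub>P K \<and>
     (\<forall>L\<in>set_partitions n. I \<preceq>\<^sub>P L \<and> J \<preceq>\<^sub>P L \<longrightarrow> K \<preceq>\<^sub>P L))"

definition partition_monoid :: "nat \<Rightarrow> nat set set monoid" where
  "partition_monoid n =
    \<lparr> carrier = set_partitions n, mult = part_join n, one = (\<lambda>x. {x}) ` {1..n} \<rparr>"

definition part_act :: "(nat \<Rightarrow> nat) \<Rightarrow> nat set set \<Rightarrow> nat set set" where
  "part_act p I = (\<lambda>B. p ` B) ` I"

lemma part_le_iff_refines:
  assumes "I \<in> set_partitions n" "J \<in> set_partitions n"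
  shows "I \<preceq>\<^sub>P J \<longleftrightarrow> refines {1..n} I J"
proof
  assume le: "I \<preceq>\<^sub>P J"
  have "\<exists>Y\<in>J. X \<subseteq> Y" if X: "X \<in> I" for X
  proof -
    have "X \<noteq> {}" "X \<subseteq> \<Union>J"
      using X assms unfolding set_partitions_def partition_on_def by auto
    then obtain x B where B: "x \<in> X" "B \<in> J" "x \<in> B" by blast
    with le obtain C where C: "C \<subseteq> I" "B = \<Union>C" unfolding part_le_def by blast
    with B obtain X' where "X' \<in> C" "x \<in> X'" by blast
    then have "X' = X"
      using C X B assms unfolding set_partitions_def partition_on_def
      by (metis (no_types, lifting) CollectD disjointD disjoint_iff subsetD)
    with \<open>X' \<in> C\<close> C B show ?thesis by blast
  qed
  then show "refines {1..n} I J"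
    using assms by (simp add: refines_def set_partitions_def)
next
  assume r: "refines {1..n} I J"
  show "I \<preceq>\<^sub>P J"
    unfolding part_le_def
  proof
    fix B assume "B \<in> J"
    then have "B = \<Union>{p \<in> I. p \<subseteq> B}"
      using refines_obtains_subset[OF r] by (auto simp: partition_on_def)
    then show "\<exists>C\<subseteq>I. B = \<Union>C" by (intro exI[of _ "{p \<in> I. p \<subseteq> B}"] conjI) auto
  qed
qed

lemma part_le_antisym:
  "I \<in> set_partitions n \<Longrightarrow> J \<in> set_partitions n \<Longrightarrow> I \<preceq>\<^sub>P J \<Longrightarrow> J \<preceq>\<^sub>P I \<Longrightarrow> I = J"
  by (metis part_le_iff_refines refines_asym)

lemma part_le_refl: "I \<preceq>\<^sub>P I"
  unfolding part_le_def by (metis ccpo_Sup_singleton empty_subsetI insert_subset)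

lemma part_le_trans:
  "I \<in> set_partitions n \<Longrightarrow> J \<in> set_partitions n \<Longrightarrow> K \<in> set_partitions n \<Longrightarrow>
    I \<preceq>\<^sub>P J \<Longrightarrow> J \<preceq>\<^sub>P K \<Longrightarrow> I \<preceq>\<^sub>P K"
  by (simp add: part_le_iff_refines) (rule refines_trans)

lemma top_partition:
  assumes "I \<in> set_partitions n"
  shows "{{1..n}} - {{}} \<in> set_partitions n" "I \<preceq>\<^sub>P {{1..n}} - {{}}"
  using assms by (auto simp: set_partitions_def partition_on_def part_le_def pairwise_def)

lemma part_join_exists:
  assumes I: "I \<in> set_partitions n" and J: "J \<in> set_partitions n"
  shows "\<exists>!K. K \<in> set_partitions n \<and> I \<preceq>\<^sub>P K \<and> J \<preceq>\<^sub>P K \<and>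
     (\<forall>L\<in>set_partitions n. I \<preceq>\<^sub>P L \<and> J \<preceq>\<^sub>P L \<longrightarrow> K \<preceq>\<^sub>P L)"
proof -
  define U where "U = {L \<in> set_partitions n. I \<preceq>\<^sub>P L \<and> J \<preceq>\<^sub>P L}"
  have ne: "U \<noteq> {}"
    using top_partition[OF I] top_partition[OF J] by (auto simp: U_def)
  have U: "partition_on {1..n} L" "refines {1..n} I L" "refines {1..n} J L" if "L \<in> U" for L
    using that I J by (auto simp: U_def part_le_iff_refines) (simp add: set_partitions_def)
  define K where "K = common_refinement U"
  have K: "K \<in> set_partitions n"
    unfolding K_def set_partitions_def using partition_on_common_refinement[OF U(1) ne] by simp
  have "refines {1..n} I K" "refines {1..n} J K"
    unfolding K_def using I J U ne
    by (auto intro!: common_refinement_coarsest simp: set_partitions_def)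
  then have le: "I \<preceq>\<^sub>P K" "J \<preceq>\<^sub>P K"
    using I J K by (simp_all add: part_le_iff_refines)
  have least: "K \<preceq>\<^sub>P L" if "L \<in> U" for L
    using refines_common_refinement[of U "{1..n}" L] U(1) that K
    by (auto simp: K_def U_def part_le_iff_refines)
  show ?thesis
  proof (rule ex1I)
    show "K \<in> set_partitions n \<and> I \<preceq>\<^sub>P K \<and> J \<preceq>\<^sub>P K \<and>
     (\<forall>L\<in>set_partitions n. I \<preceq>\<^sub>P L \<and> J \<preceq>\<^sub>P L \<longrightarrow> K \<preceq>\<^sub>P L)"
      using K le least by (auto simp: U_def)
  next
    fix K' assume K': "K' \<in> set_partitions n \<and> I \<preceq>\<^sub>P K' \<and> J \<preceq>\<^sub>P K' \<and>
     (\<forall>L\<in>set_partitions n. I \<preceq>\<^sub>P L \<and> J \<preceq>\<^sub>P L \<longrightarrow> K' \<preceq>\<^sub>P L)"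
    then have "K' \<preceq>\<^sub>P K" using K le by blast
    moreover have "K \<preceq>\<^sub>P K'" using K' least by (simp add: U_def)
    ultimately show "K' = K" using K K' part_le_antisym by blast
  qed
qed

lemma part_join:
  assumes "I \<in> set_partitions n" "J \<in> set_partitions n"
  shows part_join_closed: "part_join n I J \<in> set_partitions n"
    and part_join_upper1: "I \<preceq>\<^sub>P part_join n I J"
    and part_join_upper2: "J \<preceq>\<^sub>P part_join n I J"
    and part_join_least: "\<And>L. L \<in> set_partitions n \<Longrightarrow> I \<preceq>\<^sub>P L \<Longrightarrow> J \<preceq>\<^sub>P L \<Longrightarrow> part_join n I J \<preceq>\<^sub>P L"
  using theI'[OF part_join_exists[OF assms]] unfolding part_join_def[symmetric] by blast+

lemma part_join_eqI:
  assumes "I \<in> set_partitions n" "J \<in> set_partitions n" "K \<in> set_partitions n"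
    and "I \<preceq>\<^sub>P K" "J \<preceq>\<^sub>P K"
    and "\<And>L. L \<in> set_partitions n \<Longrightarrow> I \<preceq>\<^sub>P L \<Longrightarrow> J \<preceq>\<^sub>P L \<Longrightarrow> K \<preceq>\<^sub>P L"
  shows "part_join n I J = K"
proof (rule part_le_antisym)
  show "part_join n I J \<preceq>\<^sub>P K" by (rule part_join_least) (use assms in auto)
  show "K \<preceq>\<^sub>P part_join n I J"
    by (rule assms(6)) (use assms part_join in auto)
qed (use assms part_join_closed in auto)

lemma singletons_in_set_partitions: "(\<lambda>x. {x}) ` {1..n} \<in> set_partitions n"
  by (simp add: set_partitions_def partition_on_singletons)

lemma singletons_le: 
  assumes "I \<in> set_partitions n"
  shows "(\<lambda>x. {x}) ` {1..n} \<preceq>\<^sub>P I"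
  unfolding part_le_def
proof
  fix B assume "B \<in> I"
  then have "B \<subseteq> {1..n}" using assms by (auto simp: set_partitions_def partition_on_def)
  then have "(\<lambda>x. {x}) ` B \<subseteq> (\<lambda>x. {x}) ` {1..n}" "B = \<Union>((\<lambda>x. {x}) ` B)" by auto
  then show "\<exists>C\<subseteq>(\<lambda>x. {x}) ` {1..n}. B = \<Union>C"
    by (intro exI[of _ "(\<lambda>x. {x}) ` B"] conjI)
qed

lemma part_join_assoc:
  assumes "I \<in> set_partitions n" "J \<in> set_partitions n" "K \<in> set_partitions n"
  shows "part_join n (part_join n I J) K = part_join n I (part_join n J K)"
proof (rule part_join_eqI)
  note c = part_join_closed assms
  let ?M = "part_join n I (part_join n J K)"
  show M: "?M \<in> set_partitions n" by (intro c)
  have JK: "part_join n J K \<preceq>\<^sub>P ?M" by (intro part_join_upper2 c)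
  have I: "I \<preceq>\<^sub>P ?M" by (intro part_join_upper1 c)
  have J: "J \<preceq>\<^sub>P ?M"
    by (rule part_le_trans[where n = n, OF _ _ _ part_join_upper1[of J n K] JK]) (intro c)+
  show "K \<preceq>\<^sub>P ?M"
    by (rule part_le_trans[where n = n, OF _ _ _ part_join_upper2[of J n K] JK]) (intro c)+
  show "part_join n I J \<preceq>\<^sub>P ?M" by (intro part_join_least c I J)
  fix L assume L: "L \<in> set_partitions n" "part_join n I J \<preceq>\<^sub>P L" "K \<preceq>\<^sub>P L"
  have "I \<preceq>\<^sub>P L" 
    by (rule part_le_trans[where n = n, OF _ _ _ part_join_upper1[of I n J] L(2)]) (intro c L)+
  moreover have "J \<preceq>\<^sub>P L" 
    by (rule part_le_trans[where n = n, OF _ _ _ part_join_upper2[of I n J] L(2)]) (intro c L)+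
  ultimately show "?M \<preceq>\<^sub>P L" by (intro part_join_least c L)
qed (intro part_join_closed assms)+

lemma part_join_commute: "part_join n I J = part_join n J I"
  unfolding part_join_def by (rule arg_cong[where f = The]) auto

lemma comm_monoid_partition_monoid: "comm_monoid (partition_monoid n)"
proof (rule comm_monoidI)
  fix I assume "I \<in> carrier (partition_monoid n)"
  then have I: "I \<in> set_partitions n" by (simp add: partition_monoid_def)
  have "part_join n ((\<lambda>x. {x}) ` {1..n}) I = I"
    by (rule part_join_eqI) (use I in \<open>simp_all only: singletons_in_set_partitions singletons_le part_le_refl\<close>)
  then show "\<one>\<^bsub>partition_monoid n\<^esub> \<otimes>\<^bsub>partition_monoid n\<^esub> I = I"
    by (simp add: partition_monoid_def)
next
  show "\<one>\<^bsub>partition_monoid n\<^esub> \<in> carrier (partition_monoid n)"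
    unfolding partition_monoid_def monoid.simps partial_object.simps by (rule singletons_in_set_partitions)
next
  fix I J assume "I \<in> carrier (partition_monoid n)" "J \<in> carrier (partition_monoid n)"
  show "I \<otimes>\<^bsub>partition_monoid n\<^esub> J = J \<otimes>\<^bsub>partition_monoid n\<^esub> I"
    by (simp add: partition_monoid_def part_join_commute)
qed (simp_all add: partition_monoid_def part_join_assoc part_join_closed)

lemma part_act_closed:
  assumes "p permutes {1..n}" "I \<in> set_partitions n"
  shows "part_act p I \<in> set_partitions n"
proof -
  have "partition_on (p ` {1..n}) ((`) p ` I - {{}})"
    using assms by (intro partition_on_inj_image)
      (auto simp: set_partitions_def intro: permutes_inj_on)
  moreover have "{} \<notin> (`) p ` I"
    using assms by (auto simp: set_partitions_def partition_on_def)
  ultimately show ?thesis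
    using assms by (simp add: permutes_image set_partitions_def part_act_def)
qed

lemma part_act_comp: "part_act (p \<circ> q) I = part_act p (part_act q I)"
  by (simp add: part_act_def image_comp comp_def)

lemma part_act_id: "part_act id I = I"
  by (simp add: part_act_def)

lemma part_act_mono: "I \<preceq>\<^sub>P J \<Longrightarrow> part_act p I \<preceq>\<^sub>P part_act p J"
  unfolding part_le_def part_act_def
proof
  fix B assume le: "\<forall>B\<in>J. \<exists>C\<subseteq>I. B = \<Union>C" and "B \<in> (`) p ` J"
  then obtain B' where B': "B' \<in> J" "B = p ` B'" by blast
  with le obtain C where C: "C \<subseteq> I" "B' = \<Union>C" by meson
  have "(`) p ` C \<subseteq> (`) p ` I" using C(1) by (rule image_mono)
  moreover have "B = \<Union>((`) p ` C)" unfolding B'(2) C(2) by (rule image_Union)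
  ultimately show "\<exists>C\<subseteq>(`) p ` I. B = \<Union>C" by (intro exI[of _ "(`) p ` C"] conjI)
qed

lemma part_act_join:
  assumes p: "p permutes {1..n}" and I: "I \<in> set_partitions n" and J: "J \<in> set_partitions n"
  shows "part_act p (part_join n I J) = part_join n (part_act p I) (part_act p J)"
proof (rule HOL.sym, rule part_join_eqI)
  note c = part_join_closed part_act_closed p I J permutes_inv
  show "part_act p I \<in> set_partitions n" "part_act p J \<in> set_partitions n"
    "part_act p (part_join n I J) \<in> set_partitions n" by (intro c)+
  show "part_act p I \<preceq>\<^sub>P part_act p (part_join n I J)" 
    "part_act p J \<preceq>\<^sub>P part_act p (part_join n I J)"
    by (intro part_act_mono part_join_upper1 part_join_upper2 I J)+
  fix L assume L: "L \<in> set_partitions n" "part_act p I \<preceq>\<^sub>P L" "part_act p J \<preceq>\<^sub>P L"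
  have inv: "part_act (inv' p) (part_act p X) = X" "part_act p (part_act (inv' p) X) = X" for X
    using permutes_inv_o[OF p] by (simp_all flip: part_act_comp add: part_act_id)
  have "part_join n I J \<preceq>\<^sub>P part_act (inv' p) L"
    using part_act_mono[OF L(2), of "inv' p"] part_act_mono[OF L(3), of "inv' p"]
    by (intro part_join_least c L) (simp_all add: inv)
  from part_act_mono[OF this, of p] show "part_act p (part_join n I J) \<preceq>\<^sub>P L" by (simp add: inv)
qed


section \<open>Singular braids and tied singular braids\<close>

text \<open>
  \<open>Sig i\<close>, \<open>SigInv i\<close>, \<open>Tau i\<close> and \<open>Eta i\<close> stand for the generators $\sigma_i$, $\sigma_i^{-1}$,
  $\tau_i$ and $\eta_i$. The generators of the singular braid monoid are those not of the form \<open>Eta i\<close>.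
\<close>

datatype gen = Sig nat | SigInv nat | Tau nat | Eta nat

definition sb_gens :: "nat \<Rightarrow> gen set" where
  "sb_gens n = Sig ` {1..<n} \<union> SigInv ` {1..<n} \<union> Tau ` {1..<n}"

definition tsb_gens :: "nat \<Rightarrow> gen set" where
  "tsb_gens n = sb_gens n \<union> Eta ` {1..<n}"

inductive_set sb_rels :: "nat \<Rightarrow> (gen list \<times> gen list) set" for n :: nat where
  sig_inv_right: "i \<in> {1..<n} \<Longrightarrow> ([Sig i, SigInv i], []) \<in> sb_rels n"
| sig_inv_left: "i \<in> {1..<n} \<Longrightarrow> ([SigInv i, Sig i], []) \<in> sb_rels n"
| sig_sig_far: "i \<in> {1..<n} \<Longrightarrow> j \<in> {1..<n} \<Longrightarrow> \<bar>int i - int j\<bar> > 1 \<Longrightarrow>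
    ([Sig i, Sig j], [Sig j, Sig i]) \<in> sb_rels n"
| sig_braid: "i \<in> {1..<n} \<Longrightarrow> j \<in> {1..<n} \<Longrightarrow> \<bar>int i - int j\<bar> = 1 \<Longrightarrow>
    ([Sig i, Sig j, Sig i], [Sig j, Sig i, Sig j]) \<in> sb_rels n"
| tau_tau_far: "i \<in> {1..<n} \<Longrightarrow> j \<in> {1..<n} \<Longrightarrow> \<bar>int i - int j\<bar> > 1 \<Longrightarrow>
    ([Tau i, Tau j], [Tau j, Tau i]) \<in> sb_rels n"
| sig_tau_far: "i \<in> {1..<n} \<Longrightarrow> j \<in> {1..<n} \<Longrightarrow> \<bar>int i - int j\<bar> > 1 \<Longrightarrow>
    ([Sig i, Tau j], [Tau j, Sig i]) \<in> sb_rels n"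
| sig_tau_same: "i \<in> {1..<n} \<Longrightarrow> ([Sig i, Tau i], [Tau i, Sig i]) \<in> sb_rels n"
| sig_sig_tau: "i \<in> {1..<n} \<Longrightarrow> j \<in> {1..<n} \<Longrightarrow> \<bar>int i - int j\<bar> = 1 \<Longrightarrow>
    ([Sig i, Sig j, Tau i], [Tau j, Sig i, Sig j]) \<in> sb_rels n"

inductive_set tsb_rels :: "nat \<Rightarrow> (gen list \<times> gen list) set" for n :: nat where
  singular_braid: "(u, v) \<in> sb_rels n \<Longrightarrow> (u, v) \<in> tsb_rels n"
| eta_eta: "i \<in> {1..<n} \<Longrightarrow> j \<in> {1..<n} \<Longrightarrow> ([Eta i, Eta j], [Eta j, Eta i]) \<in> tsb_rels n"
| eta_sig_same: "i \<in> {1..<n} \<Longrightarrow> ([Eta i, Sig i], [Sig i, Eta i]) \<in> tsb_rels n"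
| eta_sig_far: "i \<in> {1..<n} \<Longrightarrow> j \<in> {1..<n} \<Longrightarrow> \<bar>int i - int j\<bar> > 1 \<Longrightarrow>
    ([Eta i, Sig j], [Sig j, Eta i]) \<in> tsb_rels n"
| eta_sig_sig: "i \<in> {1..<n} \<Longrightarrow> j \<in> {1..<n} \<Longrightarrow> \<bar>int i - int j\<bar> = 1 \<Longrightarrow>
    ([Eta i, Sig j, Sig i], [Sig j, Sig i, Eta j]) \<in> tsb_rels n"
| eta_sig_siginv: "i \<in> {1..<n} \<Longrightarrow> j \<in> {1..<n} \<Longrightarrow> \<bar>int i - int j\<bar> = 1 \<Longrightarrow>
    ([Eta i, Sig j, SigInv i], [Sig j, SigInv i, Eta j]) \<in> tsb_rels n"
| eta_eta_sig_1: "i \<in> {1..<n} \<Longrightarrow> j \<in> {1..<n} \<Longrightarrow> \<bar>int i - int j\<bar> = 1 \<Longrightarrow>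
    ([Eta i, Eta j, Sig i], [Eta j, Sig i, Eta j]) \<in> tsb_rels n"
| eta_eta_sig_2: "i \<in> {1..<n} \<Longrightarrow> j \<in> {1..<n} \<Longrightarrow> \<bar>int i - int j\<bar> = 1 \<Longrightarrow>
    ([Eta j, Sig i, Eta j], [Sig i, Eta i, Eta j]) \<in> tsb_rels n"
| eta_idem: "i \<in> {1..<n} \<Longrightarrow> ([Eta i, Eta i], [Eta i]) \<in> tsb_rels n"
| tau_eta_same: "i \<in> {1..<n} \<Longrightarrow> ([Tau i, Eta i], [Eta i, Tau i]) \<in> tsb_rels n"
| tau_eta_far: "i \<in> {1..<n} \<Longrightarrow> j \<in> {1..<n} \<Longrightarrow> \<bar>int i - int j\<bar> > 1 \<Longrightarrow>
    ([Tau i, Eta j], [Eta j, Tau i]) \<in> tsb_rels n"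
| eta_tau_tau: "i \<in> {1..<n} \<Longrightarrow> j \<in> {1..<n} \<Longrightarrow> \<bar>int i - int j\<bar> = 1 \<Longrightarrow>
    ([Eta i, Tau j, Tau i], [Tau j, Tau i, Eta j]) \<in> tsb_rels n"
| eta_eta_tau_1: "i \<in> {1..<n} \<Longrightarrow> j \<in> {1..<n} \<Longrightarrow> \<bar>int i - int j\<bar> = 1 \<Longrightarrow>
    ([Eta i, Eta j, Tau i], [Eta j, Tau i, Eta j]) \<in> tsb_rels n"
| eta_eta_tau_2: "i \<in> {1..<n} \<Longrightarrow> j \<in> {1..<n} \<Longrightarrow> \<bar>int i - int j\<bar> = 1 \<Longrightarrow>
    ([Eta j, Tau i, Eta j], [Tau i, Eta i, Eta j]) \<in> tsb_rels n"
| eta_tau_sig: "i \<in> {1..<n} \<Longrightarrow> j \<in> {1..<n} \<Longrightarrow> \<bar>int i - int j\<bar> = 1 \<Longrightarrow>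
    ([Eta i, Tau j, Sig i], [Tau j, Sig i, Eta j]) \<in> tsb_rels n"
| eta_sig_tau: "i \<in> {1..<n} \<Longrightarrow> j \<in> {1..<n} \<Longrightarrow> \<bar>int i - int j\<bar> = 1 \<Longrightarrow>
    ([Eta i, Sig j, Tau i], [Sig j, Tau i, Eta j]) \<in> tsb_rels n"
| tau_eta: "i \<in> {1..<n} \<Longrightarrow> j \<in> {1..<n} \<Longrightarrow> \<bar>int i - int j\<bar> = 1 \<Longrightarrow>
    ([Tau i, Eta j], [Sig i, Eta j, SigInv i, Tau i]) \<in> tsb_rels n"

definition SB :: "nat \<Rightarrow> gen list set monoid" where
  "SB n = presented_monoid (sb_gens n) (sb_rels n)"

definition TSB :: "nat \<Rightarrow> gen list set monoid" where
  "TSB n = presented_monoid (tsb_gens n) (tsb_rels n)"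

lemma sb_rels_words: "sb_rels n \<subseteq> lists (sb_gens n) \<times> lists (sb_gens n)"
  by (auto simp: sb_gens_def elim!: sb_rels.cases)

lemma tsb_rels_words: "tsb_rels n \<subseteq> lists (tsb_gens n) \<times> lists (tsb_gens n)"
proof -
  have "lists (sb_gens n) \<subseteq> lists (tsb_gens n)"
    by (rule lists_mono) (simp add: tsb_gens_def)
  note le = this
  have "(u, v) \<in> lists (tsb_gens n) \<times> lists (tsb_gens n)" if "(u, v) \<in> tsb_rels n" for u v
    using that
  proof cases
    case singular_braid
    with sb_rels_words le show ?thesis by blast
  qed (auto simp: tsb_gens_def sb_gens_def)
  then show ?thesis by auto
qed

text \<open>The value at \<open>Eta i\<close> is irrelevant, since \<open>Eta i \<notin> sb_gens n\<close>.\<close>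

fun gen_perm :: "gen \<Rightarrow> nat \<Rightarrow> nat" where
  "gen_perm (Sig i) = transpose i (i + 1)"
| "gen_perm (SigInv i) = inv' (transpose i (i + 1))"
| "gen_perm (Tau i) = transpose i (i + 1)"
| "gen_perm (Eta i) = id"

definition sb_perm :: "nat \<Rightarrow> gen list set \<Rightarrow> nat \<Rightarrow> nat" where
  "sb_perm n = pres_lift (sym_group n) gen_perm"

lemma gen_perm_closed: "g \<in> sb_gens n \<Longrightarrow> gen_perm g \<in> carrier (sym_group n)"
  by (auto simp: sb_gens_def sym_group_def intro!: permutes_swap_id)

lemma gen_perm_rels:
  assumes "(u, v) \<in> sb_rels n"
  shows "word_value (sym_group n) gen_perm u = word_value (sym_group n) gen_perm v"
  using assms
  by cases (auto simp: sym_group_mult sym_group_one fun_eq_iff transpose_def)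

lemma monoid_sym_group: "monoid (sym_group n)"
  using sym_group_is_group group.is_monoid by blast

lemma sb_perm_class:
  "w \<in> lists (sb_gens n) \<Longrightarrow>
    sb_perm n (pres_cong (sb_gens n) (sb_rels n) `` {w}) = word_value (sym_group n) gen_perm w"
  unfolding sb_perm_def
  by (rule pres_lift_class[OF monoid_sym_group gen_perm_closed gen_perm_rels])

lemma sb_perm_hom: "sb_perm n \<in> hom (SB n) (sym_group n)"
  unfolding sb_perm_def SB_def
  by (rule pres_lift_hom[OF monoid_sym_group gen_perm_closed gen_perm_rels])

lemma sb_perm_one: "sb_perm n \<one>\<^bsub>SB n\<^esub> = id"
  unfolding sb_perm_def SB_def sym_group_one[of n, symmetric]
  by (rule pres_lift_one[OF monoid_sym_group gen_perm_closed gen_perm_rels])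

lemma monoid_SB: "monoid (SB n)" and monoid_TSB: "monoid (TSB n)"
  by (simp_all add: SB_def TSB_def monoid_presented_monoid)


section \<open>The semidirect product\<close>

definition partition_semidirect_SB :: "nat \<Rightarrow> (nat set set \<times> gen list set) monoid" where
  "partition_semidirect_SB n =
    \<lparr> carrier = carrier (partition_monoid n) \<times> carrier (SB n),
      mult = (\<lambda>(I, \<alpha>) (J, \<beta>).
        (I \<otimes>\<^bsub>partition_monoid n\<^esub> part_act (sb_perm n \<alpha>) J, \<alpha> \<otimes>\<^bsub>SB n\<^esub> \<beta>)),
      one = (\<one>\<^bsub>partition_monoid n\<^esub>, \<one>\<^bsub>SB n\<^esub>) \<rparr>"

lemma monoid_partition_semidirect_SB: "monoid (partition_semidirect_SB n)"
proof -
  interpret P: comm_monoid "partition_monoid n" by (rule comm_monoid_partition_monoid)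
  interpret S: monoid "SB n" by (rule monoid_SB)
  have perm: "sb_perm n \<alpha> permutes {1..n}" if "\<alpha> \<in> carrier (SB n)" for \<alpha>
    using hom_in_carrier[OF sb_perm_hom that] by (simp add: sym_group_carrier)
  have hom: "sb_perm n (\<alpha> \<otimes>\<^bsub>SB n\<^esub> \<beta>) = sb_perm n \<alpha> \<circ> sb_perm n \<beta>"
    if "\<alpha> \<in> carrier (SB n)" "\<beta> \<in> carrier (SB n)" for \<alpha> \<beta>
    using hom_mult[OF sb_perm_hom that] by (simp add: sym_group_mult)
  have act: "part_act (sb_perm n \<alpha>) J \<in> carrier (partition_monoid n)"
    if "\<alpha> \<in> carrier (SB n)" "J \<in> carrier (partition_monoid n)" for \<alpha> J
    using that part_act_closed[OF perm] by (simp add: partition_monoid_def)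
  have act_mult: "part_act (sb_perm n \<alpha>) (I \<otimes>\<^bsub>partition_monoid n\<^esub> J) =
      part_act (sb_perm n \<alpha>) I \<otimes>\<^bsub>partition_monoid n\<^esub> part_act (sb_perm n \<alpha>) J"
    if "\<alpha> \<in> carrier (SB n)" "I \<in> carrier (partition_monoid n)" "J \<in> carrier (partition_monoid n)"
    for \<alpha> I J
    using that part_act_join[OF perm] by (simp add: partition_monoid_def)
  have act_one: "part_act (sb_perm n \<alpha>) \<one>\<^bsub>partition_monoid n\<^esub> = \<one>\<^bsub>partition_monoid n\<^esub>"
    if "\<alpha> \<in> carrier (SB n)" for \<alpha>
  proof -
    have "part_act (sb_perm n \<alpha>) \<one>\<^bsub>partition_monoid n\<^esub> = (\<lambda>x. {x}) ` (sb_perm n \<alpha> ` {1..n})"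
      by (simp add: partition_monoid_def part_act_def image_image)
    then show ?thesis
      using permutes_image[OF perm[OF that]] by (simp add: partition_monoid_def)
  qed
  show ?thesis
    by (rule monoidI)
      (auto simp: partition_semidirect_SB_def act act_mult act_one hom part_act_comp
        sb_perm_one part_act_id P.m_assoc S.m_assoc)
qed

text \<open>
  \<open>\<cong>\<close> only asks for a bijection preserving products; between monoids it also preserves the unit.
\<close>

lemma iso_monoid_one:
  assumes "monoid G" "monoid H" and h: "h \<in> iso G H"
  shows "h \<one>\<^bsub>G\<^esub> = \<one>\<^bsub>H\<^esub>"
proof -
  interpret G: monoid G by fact
  interpret H: monoid H by fact
  have hom: "h \<in> hom G H" and surj: "h ` carrier G = carrier H"
    using h by (auto simp: iso_iff)
  obtain x where x: "x \<in> carrier G" "h x = \<one>\<^bsub>H\<^esub>"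
    using surj H.one_closed by (metis imageE)
  have "h \<one>\<^bsub>G\<^esub> = h \<one>\<^bsub>G\<^esub> \<otimes>\<^bsub>H\<^esub> h x"
    using hom_in_carrier[OF hom G.one_closed] by (simp add: x)
  also have "\<dots> = h x"
    using hom_mult[OF hom G.one_closed x(1)] x(1) by simp
  finally show ?thesis by (simp add: x)
qed

end

theory Submission
  imports Defs
begin

text \<open>
  The homomorphism to the semidirect product sends \<open>Sig i\<close> and \<open>Tau i\<close> to themselves and \<open>Eta i\<close> to the
  partition with the single nontrivial block \<open>{i, i + 1}\<close>. On the other side, conjugating the \<open>Eta i\<close>
  by the \<open>Sig j\<close> gives for each pair \<open>a, b\<close> an idempotent \<open>tie a b\<close>. The ties commute, conjugation
  by \<open>Sig i\<close> permutes them by the transposition of \<open>i\<close> and \<open>i + 1\<close>, passing \<open>Tau i\<close> across a tie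
  has the same effect, and \<open>tie a b * tie b c = tie a b * tie a c\<close>. Hence every element is
  a product of ties times a singular braid, and the pairs \<open>(a, b)\<close> whose tie is absorbed by a given
  product of ties form an equivalence relation, so that the product depends only on the partition
  generated by its pairs. This gives injectivity.
\<close>


section \<open>Ties in a tied singular braid action\<close>

text \<open>For \<open>a < b\<close> this is sigma_(b-1) ... sigma_(a+1) eta_a sigma_(a+1)^-1 ...
  sigma_(b-1)^-1, which ties strands a and b. For \<open>b \<le> a\<close> it is empty, so that the
  tie of a point with itself is the identity.\<close>

fun tie_word_sorted :: "nat \<Rightarrow> nat \<Rightarrow> gen list" where
  "tie_word_sorted a 0 = []"
| "tie_word_sorted a (Suc b) =
    (if b < a then [] else if a = b then [Eta a] else Sig b # tie_word_sorted a b @ [SigInv b])"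

definition tie_word :: "nat \<Rightarrow> nat \<Rightarrow> gen list" where
  "tie_word a b = tie_word_sorted (min a b) (max a b)"

definition ties_word :: "(nat \<times> nat) list \<Rightarrow> gen list" where
  "ties_word ps = concat (map (\<lambda>(a, b). tie_word a b) ps)"

lemma tie_word_sorted_same [simp]: "tie_word_sorted a a = []"
  by (cases a) auto

lemma tie_word_same [simp]: "tie_word a a = []"
  by (simp add: tie_word_def)

text \<open>On words, the retraction of TSB_n onto SB_n that sends every eta_i to 1.\<close>

definition braid_part :: "gen list \<Rightarrow> gen list" where
  "braid_part w = filter (\<lambda>g. g \<notin> range Eta) w"

lemma braid_part_simps [simp]:
  "braid_part [] = []"
  "braid_part (Eta i # w) = braid_part w"
  "braid_part (Sig i # w) = Sig i # braid_part w"
  "braid_part (SigInv i # w) = SigInv i # braid_part w"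
  "braid_part (Tau i # w) = Tau i # braid_part w"
  "g \<notin> range Eta \<Longrightarrow> braid_part (g # w) = g # braid_part w"
  by (auto simp: braid_part_def)

text \<open>
  The relations are required as equations between compositions of total functions, so that words
  can be rewritten pointwise, with neither associativity nor carrier conditions. By Cayley's
  argument (\<open>left_action\<close> below) nothing is lost.
\<close>

locale tsb_action =
  fixes n :: nat and f :: "gen \<Rightarrow> 'x \<Rightarrow> 'x"
  assumes action_rel: "(u, v) \<in> tsb_rels n \<Longrightarrow> foldr f u x = foldr f v x"
begin

abbreviation "s i \<equiv> f (Sig i)"
abbreviation "s' i \<equiv> f (SigInv i)"
abbreviation "t i \<equiv> f (Tau i)"
abbreviation "h i \<equiv> f (Eta i)"

definition conj_sig :: "nat \<Rightarrow> ('x \<Rightarrow> 'x) \<Rightarrow> 'x \<Rightarrow> 'x" where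
  "conj_sig i g = s i \<circ> g \<circ> s' i"

definition tie_sorted :: "nat \<Rightarrow> nat \<Rightarrow> 'x \<Rightarrow> 'x" where
  "tie_sorted a b = foldr f (tie_word_sorted a b)"

definition tie :: "nat \<Rightarrow> nat \<Rightarrow> 'x \<Rightarrow> 'x" where
  "tie a b = foldr f (tie_word a b)"

section \<open>Conjugation by the braid generators\<close>

lemma s_s' [simp]: "i \<in> {1..<n} \<Longrightarrow> s i (s' i x) = x"
  and s'_s [simp]: "i \<in> {1..<n} \<Longrightarrow> s' i (s i x) = x"
  using action_rel[OF singular_braid[OF sig_inv_right]] action_rel[OF singular_braid[OF sig_inv_left]]
  by simp_all

lemma s_far:
  "\<lbrakk>i \<in> {1..<n}; j \<in> {1..<n}; \<bar>int i - int j\<bar> > 1\<rbrakk> \<Longrightarrow> s i (s j x) = s j (s i x)"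
  using action_rel[OF singular_braid[OF sig_sig_far]] by simp

lemma s'_far:
  assumes "i \<in> {1..<n}" "j \<in> {1..<n}" "\<bar>int i - int j\<bar> > 1"
  shows "s' i (s' j x) = s' j (s' i x)"
  by (metis assms s_far s_s' s'_s)

lemma s_braid:
  "\<lbrakk>i \<in> {1..<n}; j \<in> {1..<n}; \<bar>int i - int j\<bar> = 1\<rbrakk> \<Longrightarrow> s i (s j (s i x)) = s j (s i (s j x))"
  using action_rel[OF singular_braid[OF sig_braid]] by simp

lemma s'_braid:
  assumes "i \<in> {1..<n}" "j \<in> {1..<n}" "\<bar>int i - int j\<bar> = 1"
  shows "s' i (s' j (s' i x)) = s' j (s' i (s' j x))"
proof -
  let ?y = "s' i (s' j (s' i x))"
  have "x = s i (s j (s i ?y))" using assms by simp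
  also have "\<dots> = s j (s i (s j ?y))" using assms by (intro s_braid)
  finally have "s' j x = s i (s j ?y)" using assms by (metis s'_s)
  then show ?thesis using assms by (metis s'_s)
qed

lemma conj_sig_inj: "i \<in> {1..<n} \<Longrightarrow> conj_sig i g = conj_sig i k \<Longrightarrow> g = k"
  by (metis (no_types, lifting) comp_apply conj_sig_def ext s'_s)

lemma conj_sig_comp: "i \<in> {1..<n} \<Longrightarrow> conj_sig i (g \<circ> k) = conj_sig i g \<circ> conj_sig i k"
  by (simp add: conj_sig_def fun_eq_iff)

lemma conj_sig_id: "i \<in> {1..<n} \<Longrightarrow> conj_sig i id = id"
  by (simp add: conj_sig_def fun_eq_iff)

lemma conj_sig_far:
  "\<lbrakk>i \<in> {1..<n}; j \<in> {1..<n}; \<bar>int i - int j\<bar> > 1\<rbrakk> \<Longrightarrow> conj_sig i (conj_sig j g) = conj_sig j (conj_sig i g)"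
  by (simp add: conj_sig_def fun_eq_iff s_far s'_far[of j i])

lemma conj_sig_braid:
  "\<lbrakk>i \<in> {1..<n}; j \<in> {1..<n}; \<bar>int i - int j\<bar> = 1\<rbrakk> \<Longrightarrow>
    conj_sig i (conj_sig j (conj_sig i g)) = conj_sig j (conj_sig i (conj_sig j g))"
  by (simp add: conj_sig_def fun_eq_iff s_braid s'_braid)

lemma conj_sig_eqI: "i \<in> {1..<n} \<Longrightarrow> (\<And>x. s i (g x) = k (s i x)) \<Longrightarrow> conj_sig i g = k"
  by (simp add: conj_sig_def fun_eq_iff)

lemma s_move: "i \<in> {1..<n} \<Longrightarrow> s i (g x) = conj_sig i g (s i x)"
  by (simp add: conj_sig_def)

lemma conj_sig_h_same: "i \<in> {1..<n} \<Longrightarrow> conj_sig i (h i) = h i"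
  using action_rel[OF eta_sig_same, of i] by (intro conj_sig_eqI) auto

lemma conj_sig_h_far:
  "\<lbrakk>i \<in> {1..<n}; j \<in> {1..<n}; \<bar>int i - int j\<bar> > 1\<rbrakk> \<Longrightarrow> conj_sig i (h j) = h j"
  using action_rel[OF eta_sig_far, of j i] by (intro conj_sig_eqI) auto

lemma conj_sig_conj_sig_h:
  "\<lbrakk>i \<in> {1..<n}; j \<in> {1..<n}; \<bar>int i - int j\<bar> = 1\<rbrakk> \<Longrightarrow> conj_sig j (conj_sig i (h j)) = h i"
  \<comment> \<open>Evaluation at \<open>s' i (s' j x)\<close> multiplies the relation by (sigma_j
    sigma_i)^-1 on the right, which leaves \<open>h i\<close> on one side and a conjugate of
    \<open>h j\<close> on the other.\<close>
  using action_rel[OF eta_sig_sig, of i j "s' i (s' j x)" for x]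
  by (intro ext) (simp add: conj_sig_def)

text \<open>The relations with sigma_j sigma_i and with sigma_j sigma_i^-1 both carry
  \<open>h j\<close> to \<open>h i\<close>, so conjugation by sigma_i and by its inverse agree on
  \<open>h j\<close>. This is the seed of the fact that braids permute the ties through S_n.\<close>

lemma conj_sig_conj_sig_h_adj:
  assumes ij: "i \<in> {1..<n}" "j \<in> {1..<n}" "\<bar>int i - int j\<bar> = 1"
  shows "conj_sig i (conj_sig i (h j)) = h j"
proof -
  let ?g = "s' i \<circ> h j \<circ> s i"
  have "conj_sig j ?g = h i"
    using action_rel[OF eta_sig_siginv[OF ij], of "s i (s' j x)" for x] ij
    by (intro ext) (simp add: conj_sig_def)
  then have "?g = conj_sig i (h j)"
    using conj_sig_inj[OF ij(2)] conj_sig_conj_sig_h[OF ij] by metis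
  moreover have "conj_sig i ?g = h j" using ij by (simp add: conj_sig_def fun_eq_iff)
  ultimately show ?thesis by metis
qed

text \<open>One more conjugation by sigma_i turns both sides into \<open>h j\<close>. The tie of the
  outer two of three consecutive points can thus be built from either end; several critical cases
  below rest on this.\<close>

lemma conj_sig_h_adj:
  assumes ij: "i \<in> {1..<n}" "j \<in> {1..<n}" "\<bar>int i - int j\<bar> = 1"
  shows "conj_sig i (h j) = conj_sig j (h i)"
proof (rule conj_sig_inj[OF ij(1)])
  show "conj_sig i (conj_sig i (h j)) = conj_sig i (conj_sig j (h i))"
    using conj_sig_conj_sig_h_adj[OF ij] conj_sig_conj_sig_h[of j i] ij by auto
qed

section \<open>Conjugation permutes the ties\<close>

lemma tie_sorted_adj: "tie_sorted a (Suc a) = h a"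
  by (simp add: tie_sorted_def)

lemma tie_sorted_Suc: "a < b \<Longrightarrow> tie_sorted a (Suc b) = conj_sig b (tie_sorted a b)"
  by (auto simp: tie_sorted_def conj_sig_def)

text \<open>All indices in the word of \<open>tie_sorted a b\<close> lie in a, ..., b - 1, hence at
  distance at least 2 from i.\<close>

lemma conj_sig_tie_sorted_above:
  assumes "a < b" "1 \<le> a" "b < i" "i < n"
  shows "conj_sig i (tie_sorted a b) = tie_sorted a b"
  using Suc_leI[OF assms(1)] assms(3)
proof (induction rule: dec_induct)
  case base
  then show ?case using assms by (simp add: tie_sorted_adj conj_sig_h_far)
next
  case (step b)
  then show ?case using assms by (simp add: tie_sorted_Suc conj_sig_far[of i b])
qed

lemma conj_sig_tie_sorted_below:
  assumes "a < b" "1 \<le> i" "i + 1 < a" "b \<le> n"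
  shows "conj_sig i (tie_sorted a b) = tie_sorted a b"
  using Suc_leI[OF assms(1)] assms(4)
proof (induction rule: dec_induct)
  case base
  then show ?case using assms by (simp add: tie_sorted_adj conj_sig_h_far)
next
  case (step b)
  then show ?case using assms by (simp add: tie_sorted_Suc conj_sig_far[of i b])
qed

text \<open>The involution by sigma_b on \<open>tie_sorted a b\<close> passes to sigma_(b+1) on the
  next longer tie, because sigma_(b+1) fixes \<open>tie_sorted a b\<close> and the two conjugations
  satisfy the braid relation.\<close>

lemma conj_sig_conj_sig_tie_sorted_top:
  assumes "a < b" "1 \<le> a" "b < n"
  shows "conj_sig b (conj_sig b (tie_sorted a b)) = tie_sorted a b"
  using Suc_leI[OF assms(1)] assms(3)
proof (induction rule: dec_induct)
  case base
  then show ?case using assms by (simp add: tie_sorted_adj conj_sig_conj_sig_h_adj)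
next
  case (step b)
  let ?A = "conj_sig (Suc b)" and ?B = "conj_sig b" and ?x = "tie_sorted a b"
  have r: "Suc b \<in> {1..<n}" "b \<in> {1..<n}" "\<bar>int (Suc b) - int b\<bar> = 1"
    using step assms by auto
  have A: "?A ?x = ?x" using conj_sig_tie_sorted_above[of a b "Suc b"] step assms by simp
  have B: "?B (?B ?x) = ?x" using step by simp
  \<comment> \<open>Since \<open>?A\<close> fixes \<open>?x\<close>, the braid relation makes
    \<open>?B\<close> fix \<open>?A (?B ?x)\<close>. This allows a factor \<open>?B\<close> to be
    inserted in the computation that follows.\<close>
  have y: "?B (?A (?B ?x)) = ?A (?B ?x)" using conj_sig_braid[OF r, of ?x] A by simp
  have "?A (?A (?B ?x)) = ?A (?B (?A (?B ?x)))" by (simp add: y)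
  also have "\<dots> = ?B (?A (?B (?B ?x)))" by (rule conj_sig_braid[OF r])
  also have "\<dots> = ?B ?x" by (simp add: A B)
  finally show ?case using step by (simp add: tie_sorted_Suc)
qed

lemma conj_sig_tie_sorted_top:
  assumes "a < b" "1 \<le> a" "Suc b \<le> n"
  shows "conj_sig b (tie_sorted a (Suc b)) = tie_sorted a b"
  using assms by (simp add: tie_sorted_Suc conj_sig_conj_sig_tie_sorted_top)

lemma conj_sig_tie_sorted_between:
  assumes "a < b" "1 \<le> a" "a < i" "i + 1 < b" "b \<le> n"
  shows "conj_sig i (tie_sorted a b) = tie_sorted a b"
  using Suc_leI[OF assms(1)] assms(4,5)
proof (induction rule: dec_induct)
  case base
  then show ?case using assms by simp
next
  case (step b)
  show ?case
  proof (cases "i + 1 = b")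
    \<comment> \<open>Here sigma_i is adjacent to the outermost sigma_b. The braid relation moves it
      inward, where it becomes sigma_b acting on \<open>tie_sorted a i\<close>, which it
      fixes.\<close>
    case True
    have r: "i \<in> {1..<n}" "b \<in> {1..<n}" "\<bar>int i - int b\<bar> = 1"
      using step assms True by auto
    have "tie_sorted a (Suc b) = conj_sig b (conj_sig i (tie_sorted a i))"
      using step assms True by (auto simp: tie_sorted_Suc)
    then show ?thesis
      using conj_sig_braid[OF r, of "tie_sorted a i"] conj_sig_tie_sorted_above[of a i b] True assms r by simp
  next
    case False
    then show ?thesis using step assms by (simp add: tie_sorted_Suc conj_sig_far[of i b])
  qed
qed

text \<open>For b = a + 2 this exchanges the two descriptions of the outer tie given by
  \<open>conj_sig_h_adj\<close>. For larger b the further conjugations have indices at least a + 2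
  and commute with that by sigma_a.\<close>

lemma conj_sig_tie_sorted_bottom:
  assumes "Suc a < b" "1 \<le> a" "b \<le> n"
  shows "conj_sig a (tie_sorted a b) = tie_sorted (Suc a) b"
  using Suc_leI[OF assms(1)] assms(3)
proof (induction rule: dec_induct)
  case base
  then show ?case using assms
    by (simp add: tie_sorted_Suc[of a "Suc a"] tie_sorted_adj conj_sig_h_adj[of "Suc a" a] conj_sig_conj_sig_h_adj)
next
  case (step b)
  then show ?case using assms by (simp add: tie_sorted_Suc conj_sig_far[of a b])
qed

lemma conj_sig_tie_sorted_bottom':
  assumes "Suc a < b" "1 \<le> a" "b \<le> n"
  shows "conj_sig a (tie_sorted (Suc a) b) = tie_sorted a b"
  using Suc_leI[OF assms(1)] assms(3)
proof (induction rule: dec_induct)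
  case base
  then show ?case using assms
    by (simp add: tie_sorted_Suc[of a "Suc a"] tie_sorted_adj conj_sig_h_adj[of "Suc a" a])
next
  case (step b)
  then show ?case using assms by (simp add: tie_sorted_Suc conj_sig_far[of a b])
qed

lemma tie_less: "a < b \<Longrightarrow> tie a b = tie_sorted a b" "a < b \<Longrightarrow> tie b a = tie_sorted a b"
  and tie_same [simp]: "tie a a = id"
  and tie_commute: "tie a b = tie b a"
  by (simp_all add: tie_def tie_sorted_def tie_word_def min.commute max.commute)

lemma tie_adj: "tie i (Suc i) = h i"
  by (simp add: tie_less tie_sorted_adj)

lemma conj_sig_tie_less:
  assumes i: "i \<in> {1..<n}" and ab: "1 \<le> a" "a < b" "b \<le> n"
  shows "conj_sig i (tie a b) = tie (transpose i (Suc i) a) (transpose i (Suc i) b)"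
proof -
  \<comment> \<open>The possible positions of the pair i, i + 1 relative to a and b.\<close>
  consider "b < i" | "i = b" | "i + 1 = b" "i = a" | "i + 1 = b" "a < i" | "a < i" "i + 1 < b"
    | "i = a" "i + 1 < b" | "i + 1 = a" | "i + 1 < a"
    using ab by linarith
  then show ?thesis
  proof cases
    case 1
    then show ?thesis using i ab by (simp add: transpose_def tie_less conj_sig_tie_sorted_above)
  next
    case 2
    then show ?thesis using i ab by (simp add: transpose_def tie_less tie_sorted_Suc)
  next
    case 3
    then show ?thesis using i ab by (auto simp: tie_commute[of "Suc a"] tie_adj conj_sig_h_same)
  next
    case 4
    then show ?thesis
      using i ab conj_sig_tie_sorted_top[of a i] by (auto simp: transpose_def tie_less)
  next
    case 5
    then show ?thesis using i ab by (simp add: transpose_def tie_less conj_sig_tie_sorted_between)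
  next
    case 6
    then show ?thesis using i ab by (simp add: transpose_def tie_less conj_sig_tie_sorted_bottom)
  next
    case 7
    then show ?thesis using i ab conj_sig_tie_sorted_bottom'[of i b] by (auto simp: transpose_def tie_less)
  next
    case 8
    then show ?thesis using i ab by (simp add: transpose_def tie_less conj_sig_tie_sorted_below)
  qed
qed

lemma conj_sig_tie:
  assumes i: "i \<in> {1..<n}" and ab: "a \<in> {1..n}" "b \<in> {1..n}"
  shows "conj_sig i (tie a b) = tie (transpose i (Suc i) a) (transpose i (Suc i) b)"
proof (cases a b rule: linorder_cases)
  case less
  show ?thesis by (rule conj_sig_tie_less) (use assms less in auto)
next
  case equal
  then show ?thesis by (simp only: tie_same conj_sig_id[OF i])
next
  case greater
  show ?thesis unfolding tie_commute[of a] tie_commute[of _ "transpose i (Suc i) b"]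
    by (rule conj_sig_tie_less) (use assms greater in auto)
qed

section \<open>Conjugates of the singular generators\<close>

lemma conj_sig_t_same: "i \<in> {1..<n} \<Longrightarrow> conj_sig i (t i) = t i"
  using action_rel[OF singular_braid[OF sig_tau_same], of i] by (intro conj_sig_eqI) auto

lemma conj_sig_t_far:
  "\<lbrakk>i \<in> {1..<n}; j \<in> {1..<n}; \<bar>int i - int j\<bar> > 1\<rbrakk> \<Longrightarrow> conj_sig i (t j) = t j"
  using action_rel[OF singular_braid[OF sig_tau_far], of i j] by (intro conj_sig_eqI) auto

lemma conj_sig_conj_sig_t:
  "\<lbrakk>i \<in> {1..<n}; j \<in> {1..<n}; \<bar>int i - int j\<bar> = 1\<rbrakk> \<Longrightarrow> conj_sig i (conj_sig j (t i)) = t j"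
  using action_rel[OF singular_braid[OF sig_sig_tau], of i j "s' j (s' i x)" for x]
  by (intro ext) (simp add: conj_sig_def)

section \<open>Commutation and idempotence of the ties\<close>

lemma commute_conj_sig:
  assumes "i \<in> {1..<n}" "g \<circ> k = k \<circ> g"
  shows "conj_sig i g \<circ> conj_sig i k = conj_sig i k \<circ> conj_sig i g"
  by (metis assms conj_sig_comp)

lemma h_commute: "i \<in> {1..<n} \<Longrightarrow> j \<in> {1..<n} \<Longrightarrow> h i \<circ> h j = h j \<circ> h i"
  using action_rel[OF eta_eta, of i j] by (intro ext) auto

lemma h_tie_sorted_above:
  assumes "a < b" "1 \<le> a" "b < i" "i < n"
  shows "h i \<circ> tie_sorted a b = tie_sorted a b \<circ> h i"
  using Suc_leI[OF assms(1)] assms(3)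
proof (induction rule: dec_induct)
  case base
  then show ?case using assms h_commute[of i a] by (simp add: tie_sorted_adj)
next
  case (step b)
  then have "conj_sig b (h i) \<circ> conj_sig b (tie_sorted a b) = conj_sig b (tie_sorted a b) \<circ> conj_sig b (h i)"
    using assms by (intro commute_conj_sig step.IH) auto
  then show ?case using step assms by (simp add: tie_sorted_Suc conj_sig_h_far)
qed

text \<open>In each case \<open>h i\<close> and the longer tie are written as the same conjugate of
  a pair already known to commute: by sigma_b alone if it fixes \<open>h i\<close>, otherwise by
  sigma_a or by sigma_b sigma_i.\<close>

lemma h_tie_sorted:
  assumes "a < b" "1 \<le> a" "b \<le> n" "i \<in> {1..<n}"
  shows "h i \<circ> tie_sorted a b = tie_sorted a b \<circ> h i"
  using Suc_leI[OF assms(1)] assms(3,4)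
proof (induction arbitrary: i rule: dec_induct)
  case base
  then show ?case using assms h_commute[of i a] by (simp add: tie_sorted_adj)
next
  case (step b)
  have b: "b \<in> {1..<n}" "a < b" using step by auto
  note c = commute_conj_sig[OF b(1)]
  have IH: "conj_sig b (h j) \<circ> conj_sig b (tie_sorted a b) = conj_sig b (tie_sorted a b) \<circ> conj_sig b (h j)" if "j \<in> {1..<n}" for j
    using b that step.prems by (intro c step.IH) auto
  consider "\<bar>int b - int i\<bar> > 1" | "i = b" | "b = Suc i" "i = a" | "b = Suc i" "a < i" | "i = Suc b"
    using b by linarith
  then show ?case
  proof cases
    case 1
    then show ?thesis using b IH[of i] step.prems by (simp add: tie_sorted_Suc conj_sig_h_far)
  next
    case 2
    then show ?thesis using b IH[of i] by (simp add: tie_sorted_Suc conj_sig_h_same)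
  next
    case 3
    then have "tie_sorted a (Suc b) = conj_sig a (h b)"
      using b step by (simp add: tie_sorted_Suc tie_sorted_adj conj_sig_h_adj[of "Suc a" a])
    then show ?thesis
      using 3 b step.prems commute_conj_sig[OF _ h_commute, of a a b] by (simp add: conj_sig_h_same)
  next
    case 4
    then have "tie_sorted a (Suc b) = conj_sig b (conj_sig i (tie_sorted a i))" using b by (simp add: tie_sorted_Suc)
    moreover have "h i = conj_sig b (conj_sig i (h b))" using 4 b step conj_sig_conj_sig_h[of i b] by simp
    moreover have "conj_sig i (h b) \<circ> conj_sig i (tie_sorted a i) = conj_sig i (tie_sorted a i) \<circ> conj_sig i (h b)"
      using 4 assms b step by (intro commute_conj_sig h_tie_sorted_above) auto
    ultimately show ?thesis using c by metis
  next
    case 5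
    \<comment> \<open>Since sigma_i fixes the shorter tie, inserting it is free and makes both
      factors conjugates by sigma_b sigma_i.\<close>
    then have "conj_sig i (tie_sorted a b) = tie_sorted a b" using assms b step by (simp add: conj_sig_tie_sorted_above)
    then have "tie_sorted a (Suc b) = conj_sig b (conj_sig i (tie_sorted a b))" using b by (simp add: tie_sorted_Suc)
    moreover have "h i = conj_sig b (conj_sig i (h b))" using 5 b step conj_sig_conj_sig_h[of i b] by simp
    moreover have "conj_sig i (h b) \<circ> conj_sig i (tie_sorted a b) = conj_sig i (tie_sorted a b) \<circ> conj_sig i (h b)"
      using b step by (intro commute_conj_sig step.IH) auto
    ultimately show ?thesis using c by metis
  qed
qed

lemma transpose_adj_in:
  "i \<in> {1..<n} \<Longrightarrow> a \<in> {1..n} \<Longrightarrow> transpose i (Suc i) a \<in> {1..n}"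
  by (auto simp: transpose_def)

lemma tie_cases:
  obtains "a = b" | "a < b" "tie a b = tie_sorted a b" | "b < a" "tie a b = tie_sorted b a"
  using tie_less by (metis linorder_neqE_nat)

text \<open>Conjugation by sigma_b shortens one tie and only permutes the points of the other, which
  is why c and d stay general in the induction. The base case is
  \<open>h_tie_sorted\<close>.\<close>

lemma tie_sorted_tie_commute:
  assumes "a < b" "1 \<le> a" "b \<le> n" "c \<in> {1..n}" "d \<in> {1..n}"
  shows "tie_sorted a b \<circ> tie c d = tie c d \<circ> tie_sorted a b"
  using Suc_leI[OF assms(1)] assms(3-)
proof (induction arbitrary: c d rule: dec_induct)
  case base
  show ?case
    by (cases rule: tie_cases[of c d]) (use h_tie_sorted base assms in \<open>auto simp: tie_sorted_adj\<close>)
next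
  case (step b)
  then have b: "b \<in> {1..<n}" "a < b" by auto
  let ?p = "transpose b (Suc b)"
  have p: "?p c \<in> {1..n}" "?p d \<in> {1..n}"
    using step.prems by (intro transpose_adj_in b; blast)+
  have "conj_sig b (tie_sorted a b) \<circ> conj_sig b (tie (?p c) (?p d)) = conj_sig b (tie (?p c) (?p d)) \<circ> conj_sig b (tie_sorted a b)"
    using p b step.prems by (intro commute_conj_sig step.IH) auto
  then show ?case
    using conj_sig_tie[OF b(1) p] b by (simp add: tie_sorted_Suc)
qed

lemma tie_comm:
  assumes "a \<in> {1..n}" "b \<in> {1..n}" "c \<in> {1..n}" "d \<in> {1..n}"
  shows "tie a b \<circ> tie c d = tie c d \<circ> tie a b"
  by (cases rule: tie_cases[of a b]) (use tie_sorted_tie_commute assms in auto)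

lemma tie_sorted_idem:
  assumes "a < b" "1 \<le> a" "b \<le> n"
  shows "tie_sorted a b \<circ> tie_sorted a b = tie_sorted a b"
  using Suc_leI[OF assms(1)] assms(3-)
proof (induction rule: dec_induct)
  case base
  then show ?case using action_rel[OF eta_idem, of a] assms
    by (simp add: tie_sorted_adj fun_eq_iff)
next
  case (step b)
  then have b: "b \<in> {1..<n}" "a < b" by auto
  have IH: "tie_sorted a b \<circ> tie_sorted a b = tie_sorted a b" using step.prems by (intro step.IH) simp
  show ?case
    using conj_sig_comp[OF b(1), of "tie_sorted a b" "tie_sorted a b"] by (simp only: tie_sorted_Suc[OF b(2)] IH)
qed

lemma tie_idem:
  assumes "a \<in> {1..n}" "b \<in> {1..n}"
  shows "tie a b \<circ> tie a b = tie a b"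
  by (cases rule: tie_cases[of a b]) (use tie_sorted_idem assms in auto)

section \<open>Moving a generator across a tie\<close>

text \<open>For adjacent indices this is the relation tau_i eta_j = sigma_i eta_j sigma_i^-1 tau_i;
  otherwise sigma_i fixes \<open>h j\<close> and a commutation relation applies.\<close>

lemma t_h:
  assumes "i \<in> {1..<n}" "j \<in> {1..<n}"
  shows "t i \<circ> h j = conj_sig i (h j) \<circ> t i"
proof -
  consider "i = j" | "\<bar>int i - int j\<bar> = 1" | "\<bar>int i - int j\<bar> > 1" by linarith
  then show ?thesis
  proof cases
    case 1
    then show ?thesis using assms action_rel[OF tau_eta_same, of i]
      by (simp add: conj_sig_h_same fun_eq_iff)
  next
    case 2
    then show ?thesis using assms action_rel[OF tau_eta, of i j]
      by (simp add: conj_sig_def fun_eq_iff)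
  next
    case 3
    then show ?thesis using assms action_rel[OF tau_eta_far, of i j]
      by (simp add: conj_sig_h_far fun_eq_iff)
  qed
qed

lemma t_tie_sorted_above:
  assumes "a < b" "1 \<le> a" "b < i" "i < n"
  shows "t i \<circ> tie_sorted a b = tie_sorted a b \<circ> t i"
  using Suc_leI[OF assms(1)] assms(3)
proof (induction rule: dec_induct)
  case base
  then show ?case using assms t_h[of i a] by (simp add: tie_sorted_adj conj_sig_h_far)
next
  case (step b)
  then have "conj_sig b (t i) \<circ> conj_sig b (tie_sorted a b) = conj_sig b (tie_sorted a b) \<circ> conj_sig b (t i)"
    using assms by (intro commute_conj_sig step.IH) auto
  then show ?case using step assms by (simp add: tie_sorted_Suc conj_sig_t_far)
qed

text \<open>The case split is that of \<open>h_tie_sorted\<close>. In the last two cases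
  \<open>t i\<close> is written as the conjugate of \<open>t b\<close> by sigma_b sigma_i; in the
  others the conjugation applied fixes \<open>t i\<close>.\<close>

lemma t_tie_sorted:
  assumes "a < b" "1 \<le> a" "b \<le> n" "i \<in> {1..<n}"
  shows "t i \<circ> tie_sorted a b = conj_sig i (tie_sorted a b) \<circ> t i"
  using Suc_leI[OF assms(1)] assms(3,4)
proof (induction arbitrary: i rule: dec_induct)
  case base
  then show ?case using assms t_h[of i a] by (simp add: tie_sorted_adj)
next
  case (step b)
  have b: "b \<in> {1..<n}" "a < b" using step by auto
  have i: "i \<in> {1..<n}" by fact
  note c = conj_sig_comp[OF b(1)] and ci = conj_sig_comp[OF i]
  have IH: "t j \<circ> tie_sorted a b = conj_sig j (tie_sorted a b) \<circ> t j" if "j \<in> {1..<n}" for j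
    using step.prems by (intro step.IH that) simp
  consider "\<bar>int b - int i\<bar> > 1" | "i = b" | "b = Suc i" "i = a" | "b = Suc i" "a < i" | "i = Suc b"
    using b by linarith
  then show ?case
  proof cases
    case 1
    have "conj_sig b (t i) \<circ> conj_sig b (tie_sorted a b) = conj_sig b (conj_sig i (tie_sorted a b)) \<circ> conj_sig b (t i)"
      by (simp only: IH[OF i] flip: c)
    then have "t i \<circ> conj_sig b (tie_sorted a b) = conj_sig b (conj_sig i (tie_sorted a b)) \<circ> t i"
      using 1 b i by (simp add: conj_sig_t_far)
    then show ?thesis using 1 b i by (simp add: tie_sorted_Suc conj_sig_far)
  next
    case 2
    have "conj_sig b (t i) \<circ> conj_sig b (tie_sorted a b) = conj_sig b (conj_sig i (tie_sorted a b)) \<circ> conj_sig b (t i)"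
      by (simp only: IH[OF i] flip: c)
    then show ?thesis using 2 b by (simp add: tie_sorted_Suc conj_sig_t_same)
  next
    case 3
    then have "tie_sorted a (Suc b) = conj_sig a (h b)"
      using b step by (simp add: tie_sorted_Suc tie_sorted_adj conj_sig_h_adj[of "Suc a" a])
    moreover have "conj_sig i (t i) \<circ> conj_sig i (h b) = conj_sig i (conj_sig i (h b)) \<circ> conj_sig i (t i)"
      by (simp only: t_h[OF i b(1)] flip: ci)
    ultimately show ?thesis using 3 i by (simp add: conj_sig_t_same)
  next
    case 4
    then have tie_sorted: "tie_sorted a (Suc b) = conj_sig b (conj_sig i (tie_sorted a i))" using b by (simp add: tie_sorted_Suc)
    have ti: "t i = conj_sig b (conj_sig i (t b))" using 4 b i conj_sig_conj_sig_t[of b i] by simp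
    have "t b \<circ> tie_sorted a i = tie_sorted a i \<circ> t b"
      using 4 assms b by (intro t_tie_sorted_above) auto
    then have "t i \<circ> tie_sorted a (Suc b) = tie_sorted a (Suc b) \<circ> t i"
      unfolding tie_sorted ti by (intro commute_conj_sig b i)
    moreover have "conj_sig i (tie_sorted a (Suc b)) = tie_sorted a (Suc b)"
      using 4 assms b i by (intro conj_sig_tie_sorted_between) auto
    ultimately show ?thesis by simp
  next
    case 5
    then have fx: "conj_sig i (tie_sorted a b) = tie_sorted a b" using assms b step by (simp add: conj_sig_tie_sorted_above)
    have ti: "t i = conj_sig b (conj_sig i (t b))" using 5 b i conj_sig_conj_sig_t[of b i] by simp
    \<comment> \<open>As sigma_i fixes \<open>tie_sorted a b\<close>, that tie can be conjugated
      along with \<open>t b\<close>, and the induction hypothesis applies inside the conjugation.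
      The braid relation then restores the required form.\<close>
    have "t i \<circ> tie_sorted a (Suc b) = conj_sig b (conj_sig i (t b) \<circ> conj_sig i (tie_sorted a b))"
      using b by (simp add: tie_sorted_Suc ti c fx)
    also have "\<dots> = conj_sig b (conj_sig i (conj_sig b (tie_sorted a b) \<circ> t b))"
      using IH[OF b(1)] by (simp flip: ci)
    also have "\<dots> = conj_sig b (conj_sig i (conj_sig b (tie_sorted a b))) \<circ> t i"
      by (simp add: ci c flip: ti)
    also have "conj_sig b (conj_sig i (conj_sig b (tie_sorted a b))) = conj_sig i (conj_sig b (tie_sorted a b))"
      using conj_sig_braid[of b i "tie_sorted a b"] b i 5 fx by simp
    finally show ?thesis using b by (simp add: tie_sorted_Suc)
  qed
qed

lemma t_tie:
  assumes "i \<in> {1..<n}" "a \<in> {1..n}" "b \<in> {1..n}"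
  shows "t i \<circ> tie a b = tie (transpose i (Suc i) a) (transpose i (Suc i) b) \<circ> t i"
proof -
  have "t i \<circ> tie a b = conj_sig i (tie a b) \<circ> t i"
    by (cases rule: tie_cases[of a b]) (use t_tie_sorted assms in \<open>auto simp: conj_sig_id\<close>)
  then show ?thesis using conj_sig_tie[OF assms] by simp
qed

lemma s_tie:
  assumes "i \<in> {1..<n}" "a \<in> {1..n}" "b \<in> {1..n}"
  shows "s i \<circ> tie a b = tie (transpose i (Suc i) a) (transpose i (Suc i) b) \<circ> s i"
  using s_move[OF assms(1), of "tie a b"] conj_sig_tie[OF assms] by (simp add: fun_eq_iff)

lemma s'_tie:
  assumes "i \<in> {1..<n}" "a \<in> {1..n}" "b \<in> {1..n}"
  shows "s' i \<circ> tie a b = tie (transpose i (Suc i) a) (transpose i (Suc i) b) \<circ> s' i"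
proof
  fix x
  let ?p = "transpose i (Suc i)"
  \<comment> \<open>The transposition is an involution, so \<open>s_tie\<close> at the transposed
    points leads back to a and b.\<close>
  have "s i (tie (?p a) (?p b) (s' i x)) = tie a b x"
    using s_tie[of i "?p a" "?p b"] assms transpose_adj_in[OF assms(1)] by (simp add: fun_eq_iff)
  then show "(s' i \<circ> tie a b) x = (tie (?p a) (?p b) \<circ> s' i) x"
    using assms(1) by (metis comp_apply s'_s)
qed

section \<open>The triangle relation between ties\<close>

text \<open>All three pairwise products of the ties on a, b, c agree. With both equations the
  condition is invariant, up to commutation, under permuting the points.\<close>

definition triangle :: "nat \<Rightarrow> nat \<Rightarrow> nat \<Rightarrow> bool" where
  "triangle a b c \<longleftrightarrow> tie a b \<circ> tie b c = tie a c \<circ> tie b c \<and> tie a b \<circ> tie b c = tie a b \<circ> tie a c"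

text \<open>Conjugation by sigma_i is multiplicative and moves the points of every tie, so it
  transports both equations.\<close>

lemma triangle_transpose:
  assumes i: "i \<in> {1..<n}" and abc: "a \<in> {1..n}" "b \<in> {1..n}" "c \<in> {1..n}"
    and "triangle (transpose i (Suc i) a) (transpose i (Suc i) b) (transpose i (Suc i) c)"
  shows "triangle a b c"
proof -
  let ?p = "transpose i (Suc i)"
  have "conj_sig i (tie (?p x) (?p y)) = tie x y" if "x \<in> {1..n}" "y \<in> {1..n}" for x y
    using conj_sig_tie[OF i transpose_adj_in[OF i that(1)] transpose_adj_in[OF i that(2)]] by simp
  then show ?thesis
    using assms by (auto simp: triangle_def simp flip: conj_sig_comp) (metis conj_sig_comp i)+
qed

lemma triangle_base:
  assumes "1 \<le> a" "a + 2 \<le> n"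
  shows "triangle a (a + 1) (a + 2)"
proof -
  let ?b = "Suc a"
  \<comment> \<open>The relation eta_i eta_j sigma_i = eta_j sigma_i eta_j with the final sigma_i
    cancelled. Its two instances at consecutive indices give the two equations, since
    \<open>conj_sig i (h j)\<close> is then the outer tie.\<close>
  have *: "h i \<circ> h j = h j \<circ> conj_sig i (h j)"
    if ij: "i \<in> {1..<n}" "j \<in> {1..<n}" "\<bar>int i - int j\<bar> = 1" for i j
  proof
    fix x
    show "(h i \<circ> h j) x = (h j \<circ> conj_sig i (h j)) x"
      using action_rel[OF eta_eta_sig_1[OF ij], of "s' i x"] ij by (simp add: conj_sig_def)
  qed
  have ab: "a \<in> {1..<n}" "?b \<in> {1..<n}" using assms by auto
  have "tie a (Suc ?b) = conj_sig ?b (h a)" by (simp add: tie_less tie_sorted_Suc tie_sorted_adj)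
  moreover have "tie a (Suc ?b) = conj_sig a (h ?b)"
    using calculation conj_sig_h_adj[of a ?b] ab by simp
  moreover have "tie a (Suc ?b) \<circ> h ?b = h ?b \<circ> tie a (Suc ?b)"
    using tie_comm[of a "Suc ?b" ?b "Suc ?b"] assms by (simp add: tie_adj)
  ultimately show ?thesis
    using *[of a ?b] *[of ?b a] h_commute[OF ab] ab
    by (simp add: triangle_def tie_adj)
qed

lemma triangle_sorted:
  assumes "1 \<le> a" "a < b" "b < c" "c \<le> n"
  shows "triangle a b c"
  using assms
proof (induction "a + b + c" arbitrary: a b c rule: less_induct)
  case less
  \<comment> \<open>Moving c, then b, down by one lowers the sum and keeps the order, until the
    points are consecutive.\<close>
  consider "c > b + 1" | "c = b + 1" "b > a + 1" | "c = a + 2" "b = a + 1"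
    using less by linarith
  then show ?case
  proof cases
    case 1
    show ?thesis
      by (rule triangle_transpose[of "c - 1"]) (use 1 less in \<open>auto simp: transpose_def\<close>)
  next
    case 2
    show ?thesis
      by (rule triangle_transpose[of "b - 1"]) (use 2 less in \<open>auto simp: transpose_def\<close>)
  next
    case 3
    show ?thesis unfolding 3 by (rule triangle_base) (use less.prems 3 in linarith)+
  qed
qed

lemma tie_triangle:
  assumes "a \<in> {1..n}" "b \<in> {1..n}" "c \<in> {1..n}"
  shows "tie a b \<circ> tie b c = tie a b \<circ> tie a c"
proof -
  have swap: "triangle a b c \<Longrightarrow> triangle b a c" "triangle a b c \<Longrightarrow> triangle a c b"
    if "a \<in> {1..n}" "b \<in> {1..n}" "c \<in> {1..n}" for a b c
    using tie_comm[OF that(1,3) that(2,3)] tie_comm[OF that(1,2) that(2,3)] tie_comm[OF that(1,2) that(1,3)]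
    unfolding triangle_def tie_commute[of b a] tie_commute[of c b] by metis+
  have sorted: "triangle x y z" if "x < y" "y < z" "x \<in> {1..n}" "z \<in> {1..n}" for x y z
    using that by (intro triangle_sorted) auto
  consider "a = b \<or> b = c \<or> a = c" | "a < b" "b < c" | "a < c" "c < b" | "b < a" "a < c"
    | "b < c" "c < a" | "c < a" "a < b" | "c < b" "b < a"
    by linarith
  then show ?thesis
  proof cases
    \<comment> \<open>With two equal points one tie is the identity, and the claim is trivial or
      idempotence.\<close>
    case 1
    then show ?thesis using tie_idem[of a b] tie_commute[of b a] assms by auto
  qed (use assms swap sorted in \<open>metis triangle_def\<close>)+
qed

section \<open>Products of ties and absorption\<close>

definition ties :: "(nat \<times> nat) list \<Rightarrow> 'x \<Rightarrow> 'x" where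
  "ties ps = foldr f (ties_word ps)"

lemma ties_Nil [simp]: "ties [] = id"
  and ties_Cons: "ties ((a, b) # ps) = tie a b \<circ> ties ps"
  by (simp_all add: ties_def tie_def ties_word_def fun_eq_iff)

lemma tie_ties_commute:
  assumes "a \<in> {1..n}" "b \<in> {1..n}" "set ps \<subseteq> {1..n} \<times> {1..n}"
  shows "tie a b \<circ> ties ps = ties ps \<circ> tie a b"
  using assms(3)
proof (induction ps)
  case (Cons p ps)
  obtain c d where p: "p = (c, d)" by force
  have IH: "tie a b \<circ> ties ps = ties ps \<circ> tie a b" using Cons.prems by (intro Cons.IH) auto
  have "tie a b \<circ> tie c d = tie c d \<circ> tie a b" using Cons.prems assms by (intro tie_comm) (auto simp: p)
  then show ?case unfolding p ties_Cons using IH by (metis comp_assoc)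
qed simp

lemma ties_absorb:
  assumes "set ps \<subseteq> {1..n} \<times> {1..n}" "(a, b) \<in> set ps"
  shows "ties ps \<circ> tie a b = ties ps"
  using assms
proof (induction ps)
  case (Cons p ps)
  obtain c d where p: "p = (c, d)" by force
  have ab: "a \<in> {1..n}" "b \<in> {1..n}" and ps: "set ps \<subseteq> {1..n} \<times> {1..n}" 
    using Cons.prems by auto
  show ?case
  proof (cases "(a, b) \<in> set ps")
    case True
    with ps have "ties ps \<circ> tie a b = ties ps" by (rule Cons.IH)
    then show ?thesis by (simp only: p ties_Cons comp_assoc)
  next
    case False
    then have "p = (a, b)" using Cons.prems by auto
    then have "ties (p # ps) \<circ> tie a b = (tie a b \<circ> tie a b) \<circ> ties ps"
      using tie_ties_commute[OF ab ps] by (metis ties_Cons comp_assoc)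
    then show ?thesis using tie_idem[OF ab] by (simp only: \<open>p = (a, b)\<close> ties_Cons)
  qed
qed simp

text \<open>Next to an absorbed \<open>tie a b\<close>, the triangle relation exchanges
  \<open>tie a c\<close> for \<open>tie b c\<close>.\<close>

lemma ties_absorb_trans:
  assumes "a \<in> {1..n}" "b \<in> {1..n}" "c \<in> {1..n}"
    and ab: "ties ps \<circ> tie a b = ties ps" and bc: "ties ps \<circ> tie b c = ties ps"
  shows "ties ps \<circ> tie a c = ties ps"
proof -
  have "ties ps \<circ> tie a c = ties ps \<circ> (tie a b \<circ> tie a c)" using ab by (metis comp_assoc)
  also have "\<dots> = ties ps \<circ> (tie a b \<circ> tie b c)" using tie_triangle assms by simp
  also have "\<dots> = ties ps" using ab bc by (metis comp_assoc)
  finally show ?thesis .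
qed

lemma ties_absorb_ties:
  "(\<And>a b. (a, b) \<in> set qs \<Longrightarrow> ties ps \<circ> tie a b = ties ps) \<Longrightarrow> ties ps \<circ> ties qs = ties ps"
proof (induction qs)
  case (Cons p qs)
  obtain c d where p: "p = (c, d)" by force
  have "ties ps \<circ> tie c d = ties ps" by (rule Cons.prems) (simp add: p)
  moreover have "ties ps \<circ> ties qs = ties ps" by (rule Cons.IH, rule Cons.prems) simp
  ultimately show ?case unfolding p ties_Cons by (metis comp_assoc)
qed simp

lemma ties_commute:
  "set ps \<subseteq> {1..n} \<times> {1..n} \<Longrightarrow> set qs \<subseteq> {1..n} \<times> {1..n} \<Longrightarrow>
    ties ps \<circ> ties qs = ties qs \<circ> ties ps"
proof (induction qs)
  case (Cons p qs)
  obtain c d where p: "p = (c, d)" by force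
  have "tie c d \<circ> ties ps = ties ps \<circ> tie c d" 
    using Cons.prems by (intro tie_ties_commute) (auto simp: p)
  moreover have "ties ps \<circ> ties qs = ties qs \<circ> ties ps" using Cons.prems by (intro Cons.IH) auto
  ultimately show ?case unfolding p ties_Cons by (metis comp_assoc)
qed simp

text \<open>Each product absorbs the other and they commute, so both equal
  \<open>ties ps \<circ> ties qs\<close>.\<close>

lemma ties_eqI:
  assumes "set ps \<subseteq> {1..n} \<times> {1..n}" "set qs \<subseteq> {1..n} \<times> {1..n}"
    and "\<And>a b. (a, b) \<in> set qs \<Longrightarrow> ties ps \<circ> tie a b = ties ps"
    and "\<And>a b. (a, b) \<in> set ps \<Longrightarrow> ties qs \<circ> tie a b = ties qs"
  shows "ties ps = ties qs"
  using ties_absorb_ties[OF assms(3)] ties_absorb_ties[OF assms(4)] ties_commute[OF assms(1,2)]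
  by metis

section \<open>Normal form: ties followed by a singular braid\<close>

lemma gen_tie:
  assumes "g \<in> sb_gens n" "a \<in> {1..n}" "b \<in> {1..n}"
  shows "f g \<circ> tie a b = tie (gen_perm g a) (gen_perm g b) \<circ> f g"
proof -
  consider i where "g = Sig i" "i \<in> {1..<n}" | i where "g = SigInv i" "i \<in> {1..<n}"
    | i where "g = Tau i" "i \<in> {1..<n}"
    using assms(1) unfolding sb_gens_def by blast
  then show ?thesis
    by cases (use s_tie s'_tie t_tie assms in simp_all)
qed

lemma gen_perm_in:
  assumes "g \<in> sb_gens n" "a \<in> {1..n}"
  shows "gen_perm g a \<in> {1..n}"
  using gen_perm_closed[OF assms(1)] assms(2) permutes_in_image
  by (metis mem_Collect_eq partial_object.select_convs(1) sym_group_def)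

lemma gen_ties:
  assumes "g \<in> sb_gens n" "set ps \<subseteq> {1..n} \<times> {1..n}"
  shows "f g \<circ> ties ps = ties (map (map_prod (gen_perm g) (gen_perm g)) ps) \<circ> f g"
  using assms(2)
proof (induction ps)
  case (Cons p ps)
  obtain a b where p: "p = (a, b)" by force
  have "f g \<circ> tie a b = tie (gen_perm g a) (gen_perm g b) \<circ> f g"
    using Cons.prems by (intro gen_tie assms(1)) (auto simp: p)
  moreover have "f g \<circ> ties ps = ties (map (map_prod (gen_perm g) (gen_perm g)) ps) \<circ> f g"
    using Cons.prems by (intro Cons.IH) auto
  ultimately show ?case unfolding p list.map map_prod_simp ties_Cons by (metis comp_assoc)
qed simp

text \<open>The word is processed from its right end: eta_i contributes the pair i, i + 1, and any
  other generator moves to the right of all ties, permuting their points.\<close>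

lemma normal_form:
  assumes "w \<in> lists (tsb_gens n)"
  obtains ps where "set ps \<subseteq> {1..n} \<times> {1..n}" "foldr f w = ties ps \<circ> foldr f (braid_part w)"
proof -
  have "\<exists>ps. set ps \<subseteq> {1..n} \<times> {1..n} \<and> foldr f w = ties ps \<circ> foldr f (braid_part w)"
    using assms
  proof (induction w)
    case Nil
    show ?case by (intro exI[of _ "[]"]) simp
  next
    case (Cons g w)
    then obtain ps where ps: "set ps \<subseteq> {1..n} \<times> {1..n}" 
      and w: "foldr f w = ties ps \<circ> foldr f (braid_part w)" by blast
    show ?case
    proof (cases "g \<in> range Eta")
      case True
      then obtain i where g: "g = Eta i" by auto
      then have i: "i \<in> {1..<n}" using Cons.hyps by (auto simp: tsb_gens_def sb_gens_def)
      have "foldr f (g # w) = ties ((i, Suc i) # ps) \<circ> foldr f (braid_part (g # w))"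
        by (simp add: g w ties_Cons tie_adj comp_assoc)
      then show ?thesis using ps i by (intro exI[of _ "(i, Suc i) # ps"]) auto
    next
      case False
      then have g: "g \<in> sb_gens n" using Cons.hyps by (auto simp: tsb_gens_def)
      let ?qs = "map (map_prod (gen_perm g) (gen_perm g)) ps"
      have "set ?qs \<subseteq> {1..n} \<times> {1..n}"
        using ps gen_perm_in[OF g] by fastforce
      moreover have "foldr f (g # w) = (f g \<circ> ties ps) \<circ> foldr f (braid_part w)"
        by (simp add: w comp_assoc)
      moreover have "\<dots> = ties ?qs \<circ> foldr f (braid_part (g # w))"
        unfolding gen_ties[OF g ps] using False by (simp add: comp_assoc)
      ultimately show ?thesis by metis
    qed
  qed
  then show thesis using that by blast
qed

end

section \<open>Set partitions and words\<close>

definition same_block :: "nat set set \<Rightarrow> nat \<Rightarrow> nat \<Rightarrow> bool" where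
  "same_block L a b \<longleftrightarrow> (\<exists>B\<in>L. a \<in> B \<and> b \<in> B)"

text \<open>The case a = b is allowed and gives the discrete partition when a lies in
  \<open>{1..n}\<close>, in accordance with \<open>tie a a = id\<close>.\<close>

definition pair_partition :: "nat \<Rightarrow> nat \<Rightarrow> nat \<Rightarrow> nat set set" where
  "pair_partition n a b = insert {a, b} ((\<lambda>x. {x}) ` ({1..n} - {a, b}))"

definition discrete :: "nat \<Rightarrow> nat set set" where
  "discrete n = (\<lambda>x. {x}) ` {1..n}"

lemma discrete_closed [simp]: "discrete n \<in> set_partitions n"
  unfolding discrete_def by (rule singletons_in_set_partitions)

lemma discrete_le [simp]: "L \<in> set_partitions n \<Longrightarrow> discrete n \<preceq>\<^sub>P L"
  unfolding discrete_def by (rule singletons_le)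

lemma same_block_sym: "same_block L a b \<longleftrightarrow> same_block L b a"
  by (auto simp: same_block_def)

lemma same_block_refl: "L \<in> set_partitions n \<Longrightarrow> a \<in> {1..n} \<Longrightarrow> same_block L a a"
  by (auto simp: same_block_def set_partitions_def partition_on_def)

lemma same_block_in: "L \<in> set_partitions n \<Longrightarrow> same_block L a b \<Longrightarrow> a \<in> {1..n} \<and> b \<in> {1..n}"
  unfolding same_block_def set_partitions_def partition_on_def by blast

lemma same_block_unique:
  assumes "L \<in> set_partitions n" "B \<in> L" "a \<in> B" "same_block L a b"
  shows "b \<in> B"
  using assms unfolding same_block_def set_partitions_def partition_on_def
  by (metis (no_types, lifting) disjointD disjoint_iff mem_Collect_eq)

lemma same_block_trans:
  "L \<in> set_partitions n \<Longrightarrow> same_block L a b \<Longrightarrow> same_block L b c \<Longrightarrow> same_block L a c"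
  by (metis same_block_def same_block_unique)

lemma part_le_iff_same_block:
  assumes I: "I \<in> set_partitions n" and J: "J \<in> set_partitions n"
  shows "I \<preceq>\<^sub>P J \<longleftrightarrow> (\<forall>a b. same_block I a b \<longrightarrow> same_block J a b)"
proof
  assume "I \<preceq>\<^sub>P J"
  then show "\<forall>a b. same_block I a b \<longrightarrow> same_block J a b"
    unfolding part_le_iff_refines[OF assms] refines_def same_block_def by blast
next
  assume le: "\<forall>a b. same_block I a b \<longrightarrow> same_block J a b"
  have "\<exists>Y\<in>J. X \<subseteq> Y" if X: "X \<in> I" for X
  proof -
    have "X \<noteq> {}" using I X by (auto simp: set_partitions_def partition_on_def)
    then obtain x where x: "x \<in> X" by blast
    have "same_block J x y" if "y \<in> X" for y
      using le x X that by (auto simp: same_block_def)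
    then show ?thesis
      using same_block_unique[OF J] x unfolding same_block_def by (metis subsetI)
  qed
  then show "I \<preceq>\<^sub>P J"
    using assms by (simp add: part_le_iff_refines refines_def set_partitions_def)
qed

lemma pair_partition_closed:
  assumes "a \<in> {1..n}" "b \<in> {1..n}"
  shows "pair_partition n a b \<in> set_partitions n"
  using assms by (auto simp: set_partitions_def partition_on_def pair_partition_def disjoint_def)

lemma pair_partition_le_iff:
  assumes "a \<in> {1..n}" "b \<in> {1..n}" "L \<in> set_partitions n"
  shows "pair_partition n a b \<preceq>\<^sub>P L \<longleftrightarrow> same_block L a b"
proof -
  have "same_block (pair_partition n a b) x y \<longleftrightarrow>
      x \<in> {1..n} \<and> x = y \<or> {x, y} \<subseteq> {a, b}" for x y
    using assms(1,2) by (auto simp: same_block_def pair_partition_def)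
  then show ?thesis
    unfolding part_le_iff_same_block[OF pair_partition_closed[OF assms(1,2)] assms(3)]
    using assms same_block_sym[of L a b] by (auto intro: same_block_refl)
qed

text \<open>Antisymmetry, with I and J themselves as test partitions. Together with
  \<open>part_join_le_iff\<close> it lets joins be handled as conjunctions of conditions on
  L.\<close>

lemma set_partitions_eqI:
  assumes "I \<in> set_partitions n" "J \<in> set_partitions n"
    and "\<And>L. L \<in> set_partitions n \<Longrightarrow> I \<preceq>\<^sub>P L \<longleftrightarrow> J \<preceq>\<^sub>P L"
  shows "I = J"
  using assms part_le_antisym part_le_refl by metis

lemma part_join_le_iff:
  assumes "I \<in> set_partitions n" "J \<in> set_partitions n" "L \<in> set_partitions n"
  shows "part_join n I J \<preceq>\<^sub>P L \<longleftrightarrow> I \<preceq>\<^sub>P L \<and> J \<preceq>\<^sub>P L"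
proof
  assume *: "part_join n I J \<preceq>\<^sub>P L"
  have "I \<preceq>\<^sub>P part_join n I J" "J \<preceq>\<^sub>P part_join n I J" "part_join n I J \<in> set_partitions n"
    by (intro part_join_upper1 part_join_upper2 part_join_closed assms)+
  with * show "I \<preceq>\<^sub>P L \<and> J \<preceq>\<^sub>P L" using assms part_le_trans by blast
qed (use assms part_join_least in blast)

lemma part_act_pair_partition:
  assumes "p permutes {1..n}"
  shows "part_act p (pair_partition n a b) = pair_partition n (p a) (p b)"
proof -
  have "(\<lambda>x. {p x}) ` ({1..n} - {a, b}) = (\<lambda>x. {x}) ` (p ` ({1..n} - {a, b}))"
    by (simp only: image_image)
  also have "p ` ({1..n} - {a, b}) = {1..n} - {p a, p b}"
    by (simp only: image_set_diff[OF permutes_inj[OF assms]] permutes_image[OF assms]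
      image_insert image_empty)
  finally show ?thesis by (simp add: part_act_def pair_partition_def image_image)
qed

lemma part_act_discrete:
  assumes "p permutes {1..n}"
  shows "part_act p (discrete n) = discrete n"
proof -
  have "part_act p (discrete n) = (\<lambda>x. {x}) ` (p ` {1..n})" by (simp add: part_act_def discrete_def image_image)
  then show ?thesis by (simp only: permutes_image[OF assms] discrete_def)
qed

lemma part_join_discrete:
  assumes "I \<in> set_partitions n"
  shows "part_join n (discrete n) I = I" "part_join n I (discrete n) = I"
proof -
  interpret P: comm_monoid "partition_monoid n" by (rule comm_monoid_partition_monoid)
  show "part_join n (discrete n) I = I" "part_join n I (discrete n) = I"
    using P.l_one[of I] P.r_one[of I] assms by (simp_all add: partition_monoid_def discrete_def)
qed

section \<open>Partitions generated by pairs\<close>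

fun ties_part :: "nat \<Rightarrow> (nat \<times> nat) list \<Rightarrow> nat set set" where
  "ties_part n [] = discrete n"
| "ties_part n ((a, b) # ps) = part_join n (pair_partition n a b) (ties_part n ps)"

lemma ties_part_closed:
  "set ps \<subseteq> {1..n} \<times> {1..n} \<Longrightarrow> ties_part n ps \<in> set_partitions n"
  by (induction n ps rule: ties_part.induct)
     (auto intro!: part_join_closed pair_partition_closed)

lemma ties_part_le_iff:
  assumes "set ps \<subseteq> {1..n} \<times> {1..n}" "L \<in> set_partitions n"
  shows "ties_part n ps \<preceq>\<^sub>P L \<longleftrightarrow> (\<forall>(a, b)\<in>set ps. same_block L a b)"
  using assms(1)
proof (induction ps)
  case Nil
  show ?case using assms(2) by simp
next
  case (Cons p ps)
  obtain a b where p: "p = (a, b)" by force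
  have "a \<in> {1..n}" "b \<in> {1..n}" "set ps \<subseteq> {1..n} \<times> {1..n}" using Cons.prems by (auto simp: p)
  then show ?case
    using Cons.IH assms(2) by (simp add: p part_join_le_iff pair_partition_closed ties_part_closed
      pair_partition_le_iff)
qed

lemma ex_ties_part:
  assumes "I \<in> set_partitions n"
  obtains ps where "set ps \<subseteq> {1..n} \<times> {1..n}" "ties_part n ps = I"
proof -
  \<comment> \<open>A partition lies above I exactly if it joins all these pairs.\<close>
  let ?S = "{(a, b). same_block I a b}"
  have S: "?S \<subseteq> {1..n} \<times> {1..n}" using same_block_in[OF assms] by auto
  have "finite ?S" by (rule finite_subset[OF S]) simp
  from finite_list[OF this] obtain ps where ps: "set ps = ?S" ..
  then have sub: "set ps \<subseteq> {1..n} \<times> {1..n}" using S by (simp only:)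
  have "ties_part n ps = I"
  proof (rule set_partitions_eqI[OF ties_part_closed[OF sub] assms])
    fix L assume L: "L \<in> set_partitions n"
    show "ties_part n ps \<preceq>\<^sub>P L \<longleftrightarrow> I \<preceq>\<^sub>P L"
      unfolding ties_part_le_iff[OF sub L] part_le_iff_same_block[OF assms L] ps by blast
  qed
  then show thesis using that sub by blast
qed

section \<open>The partition of a word and its invariance under the relations\<close>

definition gen_part :: "nat \<Rightarrow> gen \<Rightarrow> nat set set" where
  "gen_part n g = (case g of Eta i \<Rightarrow> pair_partition n i (Suc i) | _ \<Rightarrow> discrete n)"

text \<open>The partition component of the image of a word, with the semidirect product unfolded
  letter by letter. Since \<open>gen_perm\<close> is \<open>id\<close> at \<open>Eta i\<close>, an
  eta acts trivially on what follows it.\<close>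

fun word_part :: "nat \<Rightarrow> gen list \<Rightarrow> nat set set" where
  "word_part n [] = discrete n"
| "word_part n (g # w) = part_join n (gen_part n g) (part_act (gen_perm g) (word_part n w))"

text \<open>
  Partitions are compared through the partitions above them: \<open>blocks_respect L p w\<close> says that the
  image under \<open>p\<close> of the partition of \<open>w\<close> lies below \<open>L\<close>.
\<close>

fun blocks_respect :: "nat set set \<Rightarrow> (nat \<Rightarrow> nat) \<Rightarrow> gen list \<Rightarrow> bool" where
  "blocks_respect L p [] \<longleftrightarrow> True"
| "blocks_respect L p (Eta i # w) \<longleftrightarrow> same_block L (p i) (p (Suc i)) \<and> blocks_respect L p w"
| "blocks_respect L p (g # w) \<longleftrightarrow> blocks_respect L (\<lambda>x. p (gen_perm g x)) w"

lemma gen_perm_permutes: "g \<in> tsb_gens n \<Longrightarrow> gen_perm g permutes {1..n}"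
  by (auto simp: tsb_gens_def sb_gens_def intro!: permutes_swap_id permutes_id)

lemma gen_part_closed: "g \<in> tsb_gens n \<Longrightarrow> gen_part n g \<in> set_partitions n"
  by (auto simp: gen_part_def tsb_gens_def sb_gens_def intro!: pair_partition_closed split: gen.split)

lemma word_part_closed: "w \<in> lists (tsb_gens n) \<Longrightarrow> word_part n w \<in> set_partitions n"
  by (induction w) (auto intro!: part_join_closed gen_part_closed part_act_closed gen_perm_permutes)

text \<open>The action distributes over joins, and joins split into conjunctions. The induction
  keeps p general because a letter g replaces p by its composite with
  \<open>gen_perm g\<close>.\<close>

lemma part_act_word_part_le_iff:
  assumes "w \<in> lists (tsb_gens n)" "p permutes {1..n}" "L \<in> set_partitions n"
  shows "part_act p (word_part n w) \<preceq>\<^sub>P L \<longleftrightarrow> blocks_respect L p w"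
  using assms(1,2)
proof (induction w arbitrary: p)
  case Nil
  then show ?case using assms(3) part_act_discrete[of p n] by simp
next
  case (Cons g w)
  have w: "word_part n w \<in> set_partitions n" and g: "gen_perm g permutes {1..n}"
    using Cons word_part_closed gen_perm_permutes by auto
  have pg: "(\<lambda>x. p (gen_perm g x)) permutes {1..n}"
    using permutes_compose[OF g Cons.prems] by (simp only: comp_def)
  have "part_act p (word_part n (g # w)) \<preceq>\<^sub>P L \<longleftrightarrow>
      part_act p (gen_part n g) \<preceq>\<^sub>P L \<and> blocks_respect L (\<lambda>x. p (gen_perm g x)) w"
    using Cons.IH[OF pg, unfolded part_act_comp[unfolded comp_def]] w g Cons.hyps Cons.prems assms(3)
    by (simp add: part_act_join part_join_le_iff part_act_closed gen_part_closed)
  also have "\<dots> \<longleftrightarrow> blocks_respect L p (g # w)"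
  proof (cases g)
    case (Eta i)
    then have "i \<in> {1..n}" "Suc i \<in> {1..n}" using Cons.hyps by (auto simp: tsb_gens_def sb_gens_def)
    then have "p i \<in> {1..n}" "p (Suc i) \<in> {1..n}" 
      using permutes_in_image[OF Cons.prems] by auto
    then show ?thesis using Eta Cons.prems assms(3)
      by (simp add: gen_part_def part_act_pair_partition pair_partition_le_iff)
  qed (use assms(3) part_act_discrete[OF Cons.prems] in 
      \<open>simp_all add: gen_part_def\<close>)
  finally show ?case .
qed

lemma word_part_eqI:
  assumes "u \<in> lists (tsb_gens n)" "v \<in> lists (tsb_gens n)"
    and "\<And>L. L \<in> set_partitions n \<Longrightarrow> blocks_respect L id u \<longleftrightarrow> blocks_respect L id v"
  shows "word_part n u = word_part n v"
  using assms part_act_word_part_le_iff[OF _ permutes_id]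
  by (intro set_partitions_eqI[of _ n]) (simp_all add: word_part_closed part_act_id)

lemma adjacent_cases:
  assumes "\<bar>int i - int j\<bar> = 1"
  obtains "j = Suc i" | "i = Suc j"
  using assms by linarith

text \<open>For a test partition L every relation becomes an equivalence of
  \<open>same_block\<close> conditions. The four relations with eta_i, eta_j and a crossing list
  different pairs of the same three points, hence the use of transitivity; the others match up to
  symmetry.\<close>

lemma word_part_rel:
  assumes "(u, v) \<in> tsb_rels n"
  shows "word_part n u = word_part n v"
proof (rule word_part_eqI)
  show "u \<in> lists (tsb_gens n)" "v \<in> lists (tsb_gens n)" using assms tsb_rels_words by blast+
  fix L assume L: "L \<in> set_partitions n"
  note tr = same_block_trans[OF L] and sy = same_block_sym[of L]
  show "blocks_respect L id u \<longleftrightarrow> blocks_respect L id v"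
    using assms
  proof cases
    case singular_braid
    then show ?thesis by cases simp_all
  next
    case (eta_eta_sig_1 i j)
    then show ?thesis
      by (elim adjacent_cases) (simp_all add: transpose_def, (metis tr sy)+)
  next
    case (eta_eta_sig_2 i j)
    then show ?thesis
      by (elim adjacent_cases) (simp_all add: transpose_def, (metis tr sy)+)
  next
    case (eta_eta_tau_1 i j)
    then show ?thesis
      by (elim adjacent_cases) (simp_all add: transpose_def, (metis tr sy)+)
  next
    case (eta_eta_tau_2 i j)
    then show ?thesis
      by (elim adjacent_cases) (simp_all add: transpose_def, (metis tr sy)+)
  next
    case (eta_sig_sig i j)
    then show ?thesis by (elim adjacent_cases) (simp_all add: transpose_def sy)
  next
    case (eta_sig_siginv i j)
    then show ?thesis by (elim adjacent_cases) (simp_all add: transpose_def sy)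
  next
    case (eta_tau_tau i j)
    then show ?thesis by (elim adjacent_cases) (simp_all add: transpose_def sy)
  next
    case (eta_tau_sig i j)
    then show ?thesis by (elim adjacent_cases) (simp_all add: transpose_def sy)
  next
    case (eta_sig_tau i j)
    then show ?thesis by (elim adjacent_cases) (simp_all add: transpose_def sy)
  next
    case (tau_eta i j)
    then show ?thesis by (elim adjacent_cases) (simp_all add: transpose_def sy)
  qed (auto simp: transpose_def sy)
qed

section \<open>The isomorphism\<close>

abbreviation sb_class :: "nat \<Rightarrow> gen list \<Rightarrow> gen list set" where
  "sb_class n w \<equiv> pres_cong (sb_gens n) (sb_rels n) `` {w}"

abbreviation tsb_class :: "nat \<Rightarrow> gen list \<Rightarrow> gen list set" where
  "tsb_class n w \<equiv> pres_cong (tsb_gens n) (tsb_rels n) `` {w}"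

definition gen_image :: "nat \<Rightarrow> gen \<Rightarrow> nat set set \<times> gen list set" where
  "gen_image n g = (gen_part n g, sb_class n (braid_part [g]))"

lemma sb_gens_subset: "sb_gens n \<subseteq> tsb_gens n"
  by (simp add: tsb_gens_def)

lemma sb_words_subset: "lists (sb_gens n) \<subseteq> lists (tsb_gens n)"
  by (rule lists_mono) (rule sb_gens_subset)

lemma braid_part_in: "w \<in> lists (tsb_gens n) \<Longrightarrow> braid_part w \<in> lists (sb_gens n)"
  by (induction w) (auto simp: braid_part_def tsb_gens_def)

lemma braid_part_sb: "w \<in> lists (sb_gens n) \<Longrightarrow> braid_part w = w"
  by (induction w) (auto simp: sb_gens_def)

lemma braid_part_append: "braid_part (u @ v) = braid_part u @ braid_part v"
  by (simp add: braid_part_def)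

lemma semidirect_carrier:
  "X \<in> carrier (partition_semidirect_SB n) \<longleftrightarrow>
    (\<exists>I\<in>set_partitions n. \<exists>v\<in>lists (sb_gens n). X = (I, sb_class n v))"
  by (auto simp: partition_semidirect_SB_def partition_monoid_def SB_def presented_monoid_carrier)

lemma semidirect_mult:
  assumes "u \<in> lists (sb_gens n)" "v \<in> lists (sb_gens n)"
  shows "(I, sb_class n u) \<otimes>\<^bsub>partition_semidirect_SB n\<^esub> (J, sb_class n v) =
    (part_join n I (part_act (word_value (sym_group n) gen_perm u) J), sb_class n (u @ v))"
  using assms presented_monoid_mult[OF assms, of "sb_rels n"]
  by (simp add: partition_semidirect_SB_def partition_monoid_def sb_perm_class SB_def)

lemma semidirect_one: "\<one>\<^bsub>partition_semidirect_SB n\<^esub> = (discrete n, sb_class n [])"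
  by (simp add: partition_semidirect_SB_def partition_monoid_def SB_def presented_monoid_one discrete_def)

text \<open>At \<open>Eta i\<close> this relies on the default value \<open>id\<close> of
  \<open>gen_perm\<close>, which is the permutation of the empty word.\<close>

lemma gen_perm_braid_part: "word_value (sym_group n) gen_perm (braid_part [g]) = gen_perm g"
  by (cases g) (auto simp: sym_group_mult sym_group_one image_iff)

lemma word_value_gen_image:
  "w \<in> lists (tsb_gens n) \<Longrightarrow>
    word_value (partition_semidirect_SB n) (gen_image n) w = (word_part n w, sb_class n (braid_part w))"
proof (induction w)
  case Nil
  show ?case by (simp add: semidirect_one)
next
  case (Cons g w)
  have "braid_part [g] \<in> lists (sb_gens n)" "braid_part w \<in> lists (sb_gens n)"
    using Cons by (auto intro!: braid_part_in)
  then show ?case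
    using Cons.IH[unfolded gen_image_def] Cons.prems braid_part_append[of "[g]" w]
    by (simp add: gen_image_def semidirect_mult gen_perm_braid_part)
qed

lemma gen_image_closed:
  assumes "g \<in> tsb_gens n"
  shows "gen_image n g \<in> carrier (partition_semidirect_SB n)"
proof -
  have "braid_part [g] \<in> lists (sb_gens n)" using assms by (intro braid_part_in) simp
  then show ?thesis
    unfolding gen_image_def semidirect_carrier using gen_part_closed[OF assms] by fast
qed

text \<open>Erasing the etas turns every relation outside SB_n into an identity of words, except
  \<open>tau_eta\<close>, which becomes tau_i = sigma_i sigma_i^-1 tau_i.\<close>

lemma braid_part_rel:
  assumes "(u, v) \<in> tsb_rels n"
  shows "(braid_part u, braid_part v) \<in> pres_cong (sb_gens n) (sb_rels n)"
proof -
  have in_lists: "braid_part u \<in> lists (sb_gens n)" "braid_part v \<in> lists (sb_gens n)"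
    using assms tsb_rels_words braid_part_in by blast+
  show ?thesis
    using assms
  proof cases
    case singular_braid
    then have "braid_part u = u" "braid_part v = v" using sb_rels_words braid_part_sb by blast+
    then show ?thesis using singular_braid in_lists pres_cong.base by metis
  next
    case (tau_eta i j)
    then have "([Sig i, SigInv i] @ [Tau i], [] @ [Tau i]) \<in> pres_cong (sb_gens n) (sb_rels n)"
      by (intro pres_cong.mult pres_cong.base pres_cong.refl sb_rels.sig_inv_right)
        (auto simp: sb_gens_def)
    then show ?thesis using tau_eta by (simp add: image_iff pres_cong.sym)
  qed (use in_lists in \<open>auto intro!: pres_cong.refl simp: image_iff\<close>)
qed

lemma gen_image_rels:
  assumes "(u, v) \<in> tsb_rels n"
  shows "word_value (partition_semidirect_SB n) (gen_image n) u =
    word_value (partition_semidirect_SB n) (gen_image n) v"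
proof -
  have "u \<in> lists (tsb_gens n)" "v \<in> lists (tsb_gens n)" using assms tsb_rels_words by blast+
  then show ?thesis
    using word_part_rel[OF assms] equiv_class_eq[OF equiv_pres_cong braid_part_rel[OF assms]]
    by (simp add: word_value_gen_image)
qed

definition tsb_map :: "nat \<Rightarrow> gen list set \<Rightarrow> nat set set \<times> gen list set" where
  "tsb_map n = pres_lift (partition_semidirect_SB n) (gen_image n)"

lemma tsb_map_hom: "tsb_map n \<in> hom (TSB n) (partition_semidirect_SB n)"
  unfolding tsb_map_def TSB_def
  by (rule pres_lift_hom[OF monoid_partition_semidirect_SB gen_image_closed gen_image_rels])

lemma tsb_map_class:
  "w \<in> lists (tsb_gens n) \<Longrightarrow> tsb_map n (tsb_class n w) = (word_part n w, sb_class n (braid_part w))"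
  unfolding tsb_map_def
  by (subst pres_lift_class[OF monoid_partition_semidirect_SB gen_image_closed gen_image_rels])
    (simp_all add: word_value_gen_image)

section \<open>Images of ties and of normal forms\<close>

lemma tie_word_sorted_in:
  "a \<in> {1..n} \<Longrightarrow> b \<in> {1..n} \<Longrightarrow> tie_word_sorted a b \<in> lists (tsb_gens n)"
  by (induction b) (auto simp: tsb_gens_def sb_gens_def)

lemma tie_word_in: "a \<in> {1..n} \<Longrightarrow> b \<in> {1..n} \<Longrightarrow> tie_word a b \<in> lists (tsb_gens n)"
  unfolding tie_word_def by (rule tie_word_sorted_in) auto

lemma ties_word_in: "set ps \<subseteq> {1..n} \<times> {1..n} \<Longrightarrow> ties_word ps \<in> lists (tsb_gens n)"
proof (induction ps)
  case (Cons p ps)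
  obtain a b where p: "p = (a, b)" by force
  then show ?case using Cons tie_word_in[of a n b] by (simp add: ties_word_def)
qed (simp add: ties_word_def)

text \<open>The conjugation by sigma_b cancels in the braid component, while in the partition
  component the transposition of b and b + 1 carries the block {a, b} to {a, b + 1}.\<close>

lemma word_value_tie_word_sorted:
  assumes "a \<in> {1..n}" "b \<in> {1..n}" "a \<le> b"
  shows "word_value (partition_semidirect_SB n) (gen_image n) (tie_word_sorted a b) =
    (pair_partition n a b, sb_class n [])"
  using assms(2,3)
proof (induction b)
  case (Suc b)
  let ?H = "partition_semidirect_SB n" and ?f = "gen_image n"
  interpret H: monoid ?H by (rule monoid_partition_semidirect_SB)
  consider "a = Suc b" | "a = b" | "a < b" using Suc.prems by linarith
  then show ?case
  proof cases
    case 1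
    have "pair_partition n a a = discrete n" using assms(1) by (auto simp: pair_partition_def discrete_def)
    with 1 show ?thesis by (simp add: semidirect_one)
  next
    case 2
    have "pair_partition n a (Suc a) \<in> set_partitions n"
      using 2 assms Suc.prems by (intro pair_partition_closed) auto
    then show ?thesis using 2 assms(1) Suc.prems
      by (simp add: semidirect_one gen_image_def gen_part_def semidirect_mult sym_group_one part_act_id part_join_discrete)
  next
    case 3
    have b: "Sig b \<in> sb_gens n" "SigInv b \<in> sb_gens n" "b \<in> {1..<n}" "b \<in> {1..n}" and Sb: "Suc b \<in> {1..n}"
      using 3 assms Suc.prems by (auto simp: sb_gens_def)
    have p: "transpose b (Suc b) permutes {1..n}" using b Sb by (intro permutes_swap_id)
    have T: "tie_word_sorted a b \<in> lists (tsb_gens n)" using assms b by (intro tie_word_sorted_in)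
    have S: "[SigInv b] \<in> lists (tsb_gens n)" using b sb_gens_subset by auto
    have P: "pair_partition n a b \<in> set_partitions n" "pair_partition n a (Suc b) \<in> set_partitions n"
      by (intro pair_partition_closed assms(1) b Sb)+
    have act: "part_act (transpose b (Suc b)) (pair_partition n a b) = pair_partition n a (Suc b)"
      unfolding part_act_pair_partition[OF p] using 3 by (simp add: transpose_def)
    have cls: "sb_class n [Sig b, SigInv b] = sb_class n []"
      using b by (intro equiv_class_eq[OF equiv_pres_cong] pres_cong.base sb_rels.sig_inv_right) auto
    have "word_value ?H ?f (tie_word_sorted a (Suc b)) =
        ?f (Sig b) \<otimes>\<^bsub>?H\<^esub> (word_value ?H ?f (tie_word_sorted a b) \<otimes>\<^bsub>?H\<^esub> word_value ?H ?f [SigInv b])"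
      using 3 word_value_append[OF H.monoid_axioms gen_image_closed T S] by simp
    also have "word_value ?H ?f [SigInv b] = (discrete n, sb_class n [SigInv b])"
      using part_act_discrete[OF p]
      unfolding word_value_gen_image[OF S] by (simp add: gen_part_def part_join_discrete)
    also have "word_value ?H ?f (tie_word_sorted a b) = (pair_partition n a b, sb_class n [])"
      using 3 b Suc.IH by simp
    also have "?f (Sig b) = (discrete n, sb_class n [Sig b])"
      by (simp add: gen_image_def gen_part_def image_iff)
    also have "(discrete n, sb_class n [Sig b]) \<otimes>\<^bsub>?H\<^esub>
        ((pair_partition n a b, sb_class n []) \<otimes>\<^bsub>?H\<^esub> (discrete n, sb_class n [SigInv b])) =
        (pair_partition n a (Suc b), sb_class n [])"
      using b P act cls
      by (simp add: semidirect_mult sym_group_mult sym_group_one part_act_id part_join_discrete)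
    finally show ?thesis .
  qed
qed (use assms in simp)

lemma word_value_tie_word:
  assumes "a \<in> {1..n}" "b \<in> {1..n}"
  shows "word_value (partition_semidirect_SB n) (gen_image n) (tie_word a b) =
    (pair_partition n a b, sb_class n [])"
proof (cases "a \<le> b")
  case True
  then show ?thesis using word_value_tie_word_sorted[OF assms] by (simp add: tie_word_def)
next
  case False
  then have "pair_partition n a b = pair_partition n b a"
    by (simp add: pair_partition_def insert_commute)
  then show ?thesis using word_value_tie_word_sorted[OF assms(2,1)] False by (simp add: tie_word_def)
qed

text \<open>Ties contribute only to the partition, and a word without etas only to the braid.
  Injectivity and surjectivity both rest on this formula.\<close>

lemma tsb_map_normal_form:
  assumes "set ps \<subseteq> {1..n} \<times> {1..n}" "v \<in> lists (sb_gens n)"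
  shows "tsb_map n (tsb_class n (ties_word ps @ v)) = (ties_part n ps, sb_class n v)"
proof -
  let ?H = "partition_semidirect_SB n" and ?f = "gen_image n"
  note append = word_value_append[OF monoid_partition_semidirect_SB gen_image_closed]
  note in_tsb = ties_word_in[OF assms(1)] subsetD[OF sb_words_subset assms(2)]
  have "word_value ?H ?f (ties_word ps) = (ties_part n ps, sb_class n [])"
    using assms(1)
  proof (induction ps)
    case Nil
    show ?case by (simp add: ties_word_def semidirect_one)
  next
    case (Cons p ps)
    obtain a b where p: "p = (a, b)" by force
    have ab: "a \<in> {1..n}" "b \<in> {1..n}" and ps: "set ps \<subseteq> {1..n} \<times> {1..n}"
      using Cons.prems by (auto simp: p)
    have "ties_word (p # ps) = tie_word a b @ ties_word ps" by (simp add: p ties_word_def)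
    then show ?case
      using append[OF _ tie_word_in[OF ab] ties_word_in[OF ps]] word_value_tie_word[OF ab] Cons.IH[OF ps]
      by (simp add: p semidirect_mult sym_group_one part_act_id)
  qed
  moreover have "word_value ?H ?f v = (discrete n, sb_class n v)"
  proof -
    have "word_part n v = discrete n"
      using assms(2)
    proof (induction v)
      case (Cons g v)
      then have "gen_part n g = discrete n" by (auto simp: gen_part_def sb_gens_def)
      moreover have "part_act (gen_perm g) (discrete n) = discrete n"
        using Cons.hyps sb_gens_subset by (intro part_act_discrete gen_perm_permutes) blast
      ultimately show ?case
        using Cons.IH by (simp add: part_join_discrete)
    qed simp
    then show ?thesis
      using word_value_gen_image[OF in_tsb(2)] braid_part_sb[OF assms(2)] by simp
  qed
  moreover have "tsb_map n (tsb_class n (ties_word ps @ v)) = word_value ?H ?f (ties_word ps @ v)"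
    using in_tsb by (subst tsb_map_class) (simp_all add: word_value_gen_image)
  ultimately show ?thesis
    using append[OF _ in_tsb] assms
    by (simp add: semidirect_mult sym_group_one part_act_id part_join_discrete ties_part_closed)
qed

section \<open>The left regular action of TSB_n\<close>

text \<open>Left multiplication is extended by the identity outside the carrier, since
  \<open>tsb_action\<close> asks for equations at every argument.\<close>

definition left_action :: "nat \<Rightarrow> gen \<Rightarrow> gen list set \<Rightarrow> gen list set" where
  "left_action n g X =
    (if X \<in> carrier (TSB n) then tsb_class n [g] \<otimes>\<^bsub>TSB n\<^esub> X else X)"

lemma left_action_word:
  assumes "w \<in> lists (tsb_gens n)"
  shows "foldr (left_action n) w X =
    (if X \<in> carrier (TSB n) then tsb_class n w \<otimes>\<^bsub>TSB n\<^esub> X else X)"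
  using assms
proof (induction w)
  case Nil
  interpret monoid "TSB n" by (rule monoid_TSB)
  show ?case by (simp add: TSB_def flip: presented_monoid_one) (simp flip: TSB_def)
next
  case (Cons g w)
  interpret monoid "TSB n" by (rule monoid_TSB)
  have cl: "tsb_class n u \<in> carrier (TSB n)" if "u \<in> lists (tsb_gens n)" for u
    using that by (auto simp: TSB_def presented_monoid_carrier)
  have g: "[g] \<in> lists (tsb_gens n)" using Cons.hyps by simp
  have "tsb_class n (g # w) = tsb_class n [g] \<otimes>\<^bsub>TSB n\<^esub> tsb_class n w"
    using presented_monoid_mult[OF g Cons.hyps(2), of "tsb_rels n"] by (simp add: TSB_def)
  then show ?case
    using cl[OF g] cl[OF Cons.hyps(2)] Cons.IH by (simp add: left_action_def m_assoc)
qed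

lemma left_action_eq_iff:
  assumes "u \<in> lists (tsb_gens n)" "v \<in> lists (tsb_gens n)"
  shows "foldr (left_action n) u = foldr (left_action n) v \<longleftrightarrow> tsb_class n u = tsb_class n v"
proof
  interpret monoid "TSB n" by (rule monoid_TSB)
  have cl: "tsb_class n w \<in> carrier (TSB n)" if "w \<in> lists (tsb_gens n)" for w
    using that by (auto simp: TSB_def presented_monoid_carrier)
  assume "foldr (left_action n) u = foldr (left_action n) v"
  \<comment> \<open>The regular action is faithful: the value at the unit is the class
    itself.\<close>
  then have "foldr (left_action n) u \<one>\<^bsub>TSB n\<^esub> = foldr (left_action n) v \<one>\<^bsub>TSB n\<^esub>" by simp
  then show "tsb_class n u = tsb_class n v"
    using assms cl by (simp add: left_action_word)
next
  assume "tsb_class n u = tsb_class n v"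
  then show "foldr (left_action n) u = foldr (left_action n) v"
    using assms by (simp add: left_action_word fun_eq_iff)
qed

interpretation A: tsb_action n "left_action n" for n
proof
  fix u v X
  assume uv: "(u, v) \<in> tsb_rels n"
  then have "u \<in> lists (tsb_gens n)" "v \<in> lists (tsb_gens n)" using tsb_rels_words by blast+
  moreover have "tsb_class n u = tsb_class n v"
    using calculation uv by (intro equiv_class_eq[OF equiv_pres_cong] pres_cong.base)
  ultimately show "foldr (left_action n) u X = foldr (left_action n) v X"
    using left_action_eq_iff by metis
qed

section \<open>The partition determines the product of ties\<close>

text \<open>The classes of the absorption relation form a partition that joins every pair of ps. It
  therefore lies above \<open>ties_part n ps\<close>, the least such partition.\<close>

lemma same_block_ties_absorb:
  assumes ps: "set ps \<subseteq> {1..n} \<times> {1..n}" and ab: "same_block (ties_part n ps) a b"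
  shows "A.ties n ps \<circ> A.tie n a b = A.ties n ps"
proof -
  define R where "R = {(a, b). a \<in> {1..n} \<and> b \<in> {1..n} \<and> A.ties n ps \<circ> A.tie n a b = A.ties n ps}"
  have R: "equiv {1..n} R"
  proof (rule equivI)
    show "R \<subseteq> {1..n} \<times> {1..n}" by (auto simp: R_def)
    show "refl_on {1..n} R" by (rule refl_onI) (simp add: R_def)
    show "sym R" by (rule symI) (simp add: R_def A.tie_commute)
    \<comment> \<open>This is where the triangle relation enters.\<close>
    show "trans R"
    proof (rule transI)
      fix x y z
      assume "(x, y) \<in> R" "(y, z) \<in> R"
      then show "(x, z) \<in> R"
        using A.ties_absorb_trans[of x n y z ps] unfolding R_def by blast
    qed
  qed
  then have L: "{1..n} // R \<in> set_partitions n"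
    by (simp add: set_partitions_def partition_on_quotient)
  have same: "same_block ({1..n} // R) x y \<longleftrightarrow> (x, y) \<in> R" for x y
  proof
    assume "same_block ({1..n} // R) x y"
    then show "(x, y) \<in> R"
      unfolding same_block_def using in_quotient_imp_in_rel[OF R] by auto
  next
    assume xy: "(x, y) \<in> R"
    then have x: "x \<in> {1..n}" by (simp add: R_def)
    show "same_block ({1..n} // R) x y"
      unfolding same_block_def
      by (rule bexI[OF _ quotientI[OF x]]) (use xy equiv_class_self[OF R x] in simp)
  qed
  have "ties_part n ps \<preceq>\<^sub>P {1..n} // R"
    unfolding ties_part_le_iff[OF ps L] same using ps A.ties_absorb[OF ps] by (auto simp: R_def)
  then have "same_block ({1..n} // R) a b"
    using ab part_le_iff_same_block[OF ties_part_closed[OF ps] L] by blast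
  then show ?thesis unfolding same by (simp add: R_def)
qed

lemma ties_eq_if_ties_part_eq:
  assumes ps: "set ps \<subseteq> {1..n} \<times> {1..n}" and qs: "set qs \<subseteq> {1..n} \<times> {1..n}"
    and eq: "ties_part n ps = ties_part n qs"
  shows "A.ties n ps = A.ties n qs"
proof -
  \<comment> \<open>A listed pair lies in one block of the partition it helps to generate. As the
    partitions agree, each product absorbs the pairs of the other.\<close>
  have "same_block (ties_part n rs) a b" if "set rs \<subseteq> {1..n} \<times> {1..n}" "(a, b) \<in> set rs" for rs a b
    using ties_part_le_iff[OF that(1) ties_part_closed[OF that(1)]] that(2) part_le_refl by blast
  then show ?thesis
    using ps qs eq by (intro A.ties_eqI same_block_ties_absorb) metis+
qed

lemma tsb_class_normal_form:
  assumes "w \<in> lists (tsb_gens n)"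
  obtains ps where "set ps \<subseteq> {1..n} \<times> {1..n}" "tsb_class n w = tsb_class n (ties_word ps @ braid_part w)"
proof -
  obtain ps where ps: "set ps \<subseteq> {1..n} \<times> {1..n}"
    and eq: "foldr (left_action n) w = A.ties n ps \<circ> foldr (left_action n) (braid_part w)"
    using A.normal_form[OF assms] .
  have in_lists: "ties_word ps @ braid_part w \<in> lists (tsb_gens n)"
    using ties_word_in[OF ps] braid_part_in[OF assms] sb_words_subset by auto
  have "foldr (left_action n) w = foldr (left_action n) (ties_word ps @ braid_part w)"
    unfolding eq by (simp add: A.ties_def fun_eq_iff)
  then show thesis
    using that[OF ps] left_action_eq_iff[OF assms in_lists] by simp
qed

text \<open>The relations of SB_n are among those of TSB_n, so SB_n maps to TSB_n by inclusion of
  words.\<close>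

lemma sb_class_imp_tsb_class:
  assumes "(u, v) \<in> pres_cong (sb_gens n) (sb_rels n)"
  shows "(u, v) \<in> pres_cong (tsb_gens n) (tsb_rels n)"
  using assms
proof induction
  case (base u v)
  then show ?case using sb_words_subset by (blast intro: pres_cong.base tsb_rels.singular_braid)
next
  case (refl u)
  then show ?case using sb_words_subset by (blast intro: pres_cong.refl)
qed (blast intro: pres_cong.intros)+

section \<open>Bijectivity\<close>

theorem theorem9:
  fixes n :: nat
  shows "TSB n \<cong> partition_semidirect_SB n"
proof -
  have inj: "inj_on (tsb_map n) (carrier (TSB n))"
  proof (rule inj_onI)
    fix X Y
    assume "X \<in> carrier (TSB n)" "Y \<in> carrier (TSB n)" and eq: "tsb_map n X = tsb_map n Y"
    then obtain u v where u: "u \<in> lists (tsb_gens n)" "X = tsb_class n u"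
      and v: "v \<in> lists (tsb_gens n)" "Y = tsb_class n v"
      by (auto simp: TSB_def presented_monoid_carrier)
    obtain ps where ps: "set ps \<subseteq> {1..n} \<times> {1..n}" "X = tsb_class n (ties_word ps @ braid_part u)"
      using tsb_class_normal_form[OF u(1)] u(2) by metis
    obtain qs where qs: "set qs \<subseteq> {1..n} \<times> {1..n}" "Y = tsb_class n (ties_word qs @ braid_part v)"
      using tsb_class_normal_form[OF v(1)] v(2) by metis
    note in_sb = braid_part_in[OF u(1)] braid_part_in[OF v(1)]
    \<comment> \<open>The two components of the image of a normal form are compared
      separately.\<close>
    have "ties_part n ps = ties_part n qs" and cl: "sb_class n (braid_part u) = sb_class n (braid_part v)"
      using eq unfolding ps(2) qs(2) tsb_map_normal_form[OF ps(1) in_sb(1)]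
        tsb_map_normal_form[OF qs(1) in_sb(2)] by auto
    then have ties: "A.ties n ps = A.ties n qs" using ties_eq_if_ties_part_eq ps qs by blast
    have in_tsb: "braid_part u \<in> lists (tsb_gens n)" "braid_part v \<in> lists (tsb_gens n)"
      using in_sb sb_words_subset by blast+
    \<comment> \<open>Equality of the braid parts in SB_n carries over to TSB_n, so both factors of
      the two normal forms agree.\<close>
    have "tsb_class n (braid_part u) = tsb_class n (braid_part v)"
      using cl pres_class_eq_iff[OF in_sb] pres_class_eq_iff[OF in_tsb] sb_class_imp_tsb_class by blast
    then have "foldr (left_action n) (ties_word ps @ braid_part u) =
        foldr (left_action n) (ties_word qs @ braid_part v)"
      using ties left_action_eq_iff[OF in_tsb] by (simp add: A.ties_def fun_eq_iff)
    moreover have "ties_word ps @ braid_part u \<in> lists (tsb_gens n)"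
      "ties_word qs @ braid_part v \<in> lists (tsb_gens n)"
      using in_tsb ties_word_in ps(1) qs(1) by auto
    ultimately show "X = Y" unfolding ps(2) qs(2) using left_action_eq_iff by blast
  qed
  have "Z \<in> tsb_map n ` carrier (TSB n)" if Z: "Z \<in> carrier (partition_semidirect_SB n)" for Z
  proof -
    obtain I v where I: "I \<in> set_partitions n" and v: "v \<in> lists (sb_gens n)" "Z = (I, sb_class n v)"
      using Z by (auto simp: semidirect_carrier)
    \<comment> \<open>Pairs generating I give a product of ties that realises the partition
      component.\<close>
    obtain ps where ps: "set ps \<subseteq> {1..n} \<times> {1..n}" "ties_part n ps = I"
      using ex_ties_part[OF I] .
    have "ties_word ps @ v \<in> lists (tsb_gens n)"
      using v sb_words_subset ties_word_in[OF ps(1)] by auto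
    then have "tsb_class n (ties_word ps @ v) \<in> carrier (TSB n)"
      unfolding TSB_def presented_monoid_carrier by blast
    moreover have "Z = tsb_map n (tsb_class n (ties_word ps @ v))"
      using tsb_map_normal_form[OF ps(1) v(1)] ps(2) v(2) by simp
    ultimately show ?thesis by blast
  qed
  then have "tsb_map n ` carrier (TSB n) = carrier (partition_semidirect_SB n)"
    using hom_in_carrier[OF tsb_map_hom] by blast
  with inj have "tsb_map n \<in> iso (TSB n) (partition_semidirect_SB n)"
    using tsb_map_hom by (simp add: iso_def bij_betw_def)
  then show ?thesis by (rule is_isoI)
qed

end
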